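(* Let $R$ be an algebraically closed field and let $c\in M_n(R)$. Then $c$ is diagonalizable if and only if $S_n(c,R)$ is a separable Frobenius $R$-algebra.
   Context: $M_n(R)$ is the ring of $n\times n$ matrices over $R$, and $S_n(c,R)=\{a\in M_n(R)\mid ac=ca\}$ is the centralizer algebra of $c$. An extension of unital associative algebras $A/B$ (a unital ring homomorphism $B\to A$) is a Frobenius extension if $A$ is finitely generated projective as a right $B$-module and $A\cong \mathrm{Hom}(A_B,B_B)$ as $B$-$A$-bimodules. It is separable if the multiplication map $A\otimes_B A\to A$ is a split epimorphism of $A$-$A$-bimodules. A separable Frobenius extension is a Frobenius extension that is separable. For a field $R$, an $R$-algebra $A$ is called a separable Frobenius algebra if $A/R$ is a separable Frobenius extension. *)

theory Defs
  imports
    "Jordan_Normal_Form.VS_Connect"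
    "HOL-Algebra.Free_Abelian_Groups"
    "HOL-Computational_Algebra.Polynomial"
begin

section \<open>Modules and bimodules over noncommutative rings\<close>

text \<open>
  The library locale \<^locale>\<open>module\<close> only treats modules over commutative rings. Here a module is an
  abelian group, written multiplicatively as a \<^typ>\<open>'m monoid\<close>, extended by its action(s).
\<close>

record ('m, 't) rmod = "'m monoid" +
  ract :: "'m \<Rightarrow> 't \<Rightarrow> 'm"

record ('m, 't, 's) bimod = "('m, 't) rmod" +
  lact :: "'s \<Rightarrow> 'm \<Rightarrow> 'm"

definition rmod_hom ::
  "('t, 'x) ring_scheme \<Rightarrow> ('m, 't, 'y) rmod_scheme \<Rightarrow> ('n, 't, 'z) rmod_scheme \<Rightarrow> ('m \<Rightarrow> 'n) set"
  where "rmod_hom T M N =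
    {f \<in> hom M N. \<forall>x\<in>carrier M. \<forall>t\<in>carrier T. f (ract M x t) = ract N (f x) t}"

definition bimod_hom ::
  "('s, 'w) ring_scheme \<Rightarrow> ('t, 'x) ring_scheme \<Rightarrow>
   ('m, 't, 's, 'y) bimod_scheme \<Rightarrow> ('n, 't, 's, 'z) bimod_scheme \<Rightarrow> ('m \<Rightarrow> 'n) set"
  where "bimod_hom S T M N =
    {f \<in> rmod_hom T M N. \<forall>s\<in>carrier S. \<forall>x\<in>carrier M. f (lact M s x) = lact N s (f x)}"

definition bimod_iso ::
  "('s, 'w) ring_scheme \<Rightarrow> ('t, 'x) ring_scheme \<Rightarrow>
   ('m, 't, 's, 'y) bimod_scheme \<Rightarrow> ('n, 't, 's, 'z) bimod_scheme \<Rightarrow> ('m \<Rightarrow> 'n) set"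
  where "bimod_iso S T M N = {f \<in> bimod_hom S T M N. bij_betw f (carrier M) (carrier N)}"

definition split_epi ::
  "('s, 'w) ring_scheme \<Rightarrow> ('t, 'x) ring_scheme \<Rightarrow>
   ('m, 't, 's, 'y) bimod_scheme \<Rightarrow> ('n, 't, 's, 'z) bimod_scheme \<Rightarrow> ('m \<Rightarrow> 'n) \<Rightarrow> bool"
  where "split_epi S T M N f \<longleftrightarrow>
    f \<in> bimod_hom S T M N \<and> (\<exists>g\<in>bimod_hom S T N M. \<forall>y\<in>carrier N. f (g y) = y)"

text \<open>The ring \<open>A\<close> as an \<open>S\<close>-\<open>T\<close>-bimodule along ring homomorphisms \<open>\<phi> : S \<rightarrow> A\<close> and \<open>\<psi> : T \<rightarrow> A\<close>.\<close>

definition ring_bimod ::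
  "('a, 'x) ring_scheme \<Rightarrow> ('s \<Rightarrow> 'a) \<Rightarrow> ('t \<Rightarrow> 'a) \<Rightarrow> ('a, 't, 's) bimod"
  where "ring_bimod A \<phi> \<psi> =
    \<lparr>carrier = carrier A, mult = (\<lambda>x y. x \<oplus>\<^bsub>A\<^esub> y), one = \<zero>\<^bsub>A\<^esub>,
     ract = (\<lambda>x t. x \<otimes>\<^bsub>A\<^esub> \<psi> t), lact = (\<lambda>s x. \<phi> s \<otimes>\<^bsub>A\<^esub> x)\<rparr>"

definition free_rmod :: "('t, 'x) ring_scheme \<Rightarrow> nat \<Rightarrow> (nat \<Rightarrow> 't, 't) rmod"
  where "free_rmod T m =
    \<lparr>carrier = (\<Pi>\<^sub>E i\<in>{..<m}. carrier T),
     mult = (\<lambda>u v. \<lambda>i\<in>{..<m}. u i \<oplus>\<^bsub>T\<^esub> v i), one = (\<lambda>i\<in>{..<m}. \<zero>\<^bsub>T\<^esub>),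
     ract = (\<lambda>u t. \<lambda>i\<in>{..<m}. u i \<otimes>\<^bsub>T\<^esub> t)\<rparr>"

text \<open>Finitely generated projective means being a direct summand of \<open>T\<^sup>m\<close> for some \<open>m\<close>.\<close>

definition fg_projective :: "('t, 'x) ring_scheme \<Rightarrow> ('m, 't, 'y) rmod_scheme \<Rightarrow> bool"
  where "fg_projective T M \<longleftrightarrow>
    (\<exists>m. \<exists>\<iota>\<in>rmod_hom T M (free_rmod T m). \<exists>\<pi>\<in>rmod_hom T (free_rmod T m) M.
      \<forall>x\<in>carrier M. \<pi> (\<iota> x) = x)"

text \<open>
  For an \<open>S\<close>-\<open>B\<close>-bimodule \<open>M\<close> and a \<open>T\<close>-\<open>B\<close>-bimodule \<open>N\<close>, the right \<open>B\<close>-linear maps from \<open>M\<close> to \<open>N\<close>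
  form a \<open>T\<close>-\<open>S\<close>-bimodule by \<open>(t f s)(x) = t f(s x)\<close>. Maps are made extensional on the carrier of \<open>M\<close>
  so that equality of functions is equality of homomorphisms.
\<close>

definition hom_bimod ::
  "('b, 'x) ring_scheme \<Rightarrow> ('m, 'b, 's, 'y) bimod_scheme \<Rightarrow> ('n, 'b, 't, 'z) bimod_scheme \<Rightarrow>
   ('m \<Rightarrow> 'n, 's, 't) bimod"
  where "hom_bimod B M N =
    \<lparr>carrier = rmod_hom B M N \<inter> extensional (carrier M),
     mult = (\<lambda>f g. \<lambda>x\<in>carrier M. f x \<otimes>\<^bsub>N\<^esub> g x), one = (\<lambda>x\<in>carrier M. \<one>\<^bsub>N\<^esub>),
     ract = (\<lambda>f s. \<lambda>x\<in>carrier M. f (lact M s x)),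
     lact = (\<lambda>t f. \<lambda>x\<in>carrier M. lact N t (f x))\<rparr>"


section \<open>Tensor products\<close>

text \<open>
  \<open>M \<otimes>\<^sub>B N\<close> is the free abelian group on the set of pairs \<open>(x, y)\<close> modulo the subgroup generated
  by the usual relations.
\<close>

definition tensor_rel ::
  "('b, 'x) ring_scheme \<Rightarrow> ('m, 'b, 's, 'y) bimod_scheme \<Rightarrow> ('n, 't, 'b, 'z) bimod_scheme \<Rightarrow>
   ('m \<times> 'n \<Rightarrow>\<^sub>0 int) set"
  where "tensor_rel B M N = generate (free_Abelian_group (carrier M \<times> carrier N))
    ({frag_of (x \<otimes>\<^bsub>M\<^esub> x', y) - frag_of (x, y) - frag_of (x', y) | x x' y.
        x \<in> carrier M \<and> x' \<in> carrier M \<and> y \<in> carrier N} \<union>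
     {frag_of (x, y \<otimes>\<^bsub>N\<^esub> y') - frag_of (x, y) - frag_of (x, y') | x y y'.
        x \<in> carrier M \<and> y \<in> carrier N \<and> y' \<in> carrier N} \<union>
     {frag_of (ract M x b, y) - frag_of (x, lact N b y) | x b y.
        x \<in> carrier M \<and> b \<in> carrier B \<and> y \<in> carrier N})"

definition pure_tensor ::
  "('b, 'x) ring_scheme \<Rightarrow> ('m, 'b, 's, 'y) bimod_scheme \<Rightarrow> ('n, 't, 'b, 'z) bimod_scheme \<Rightarrow>
   'm \<Rightarrow> 'n \<Rightarrow> ('m \<times> 'n \<Rightarrow>\<^sub>0 int) set"
  where "pure_tensor B M N x y =
    tensor_rel B M N #>\<^bsub>free_Abelian_group (carrier M \<times> carrier N)\<^esub> frag_of (x, y)"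

text \<open>
  For an \<open>S\<close>-\<open>B\<close>-bimodule \<open>M\<close> and a \<open>B\<close>-\<open>T\<close>-bimodule \<open>N\<close>, this is an \<open>S\<close>-\<open>T\<close>-bimodule by
  \<open>s (x \<otimes> y) t = s x \<otimes> y t\<close>. An action sends a coset \<open>X\<close> to the coset containing the image of \<open>X\<close>
  under the induced endomorphism of the free abelian group.
\<close>

definition tensor_bimod ::
  "('b, 'x) ring_scheme \<Rightarrow> ('m, 'b, 's, 'y) bimod_scheme \<Rightarrow> ('n, 't, 'b, 'z) bimod_scheme \<Rightarrow>
   (('m \<times> 'n \<Rightarrow>\<^sub>0 int) set, 't, 's) bimod"
  where "tensor_bimod B M N =
    (let F = free_Abelian_group (carrier M \<times> carrier N); K = tensor_rel B M N in
     \<lparr>carrier = carrier (F Mod K), mult = mult (F Mod K), one = one (F Mod K),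
      ract = (\<lambda>X t. K <#>\<^bsub>F\<^esub> frag_extend (\<lambda>(x, y). frag_of (x, ract N y t)) ` X),
      lact = (\<lambda>s X. K <#>\<^bsub>F\<^esub> frag_extend (\<lambda>(x, y). frag_of (lact M s x, y)) ` X)\<rparr>)"


section \<open>Separable Frobenius extensions\<close>

definition ring_extension ::
  "('a, 'x) ring_scheme \<Rightarrow> ('b, 'y) ring_scheme \<Rightarrow> ('b \<Rightarrow> 'a) \<Rightarrow> bool"
  where "ring_extension A B \<phi> \<longleftrightarrow> ring A \<and> ring B \<and> \<phi> \<in> Ring.ring_hom B A"

definition frobenius_extension ::
  "('a, 'x) ring_scheme \<Rightarrow> ('b, 'y) ring_scheme \<Rightarrow> ('b \<Rightarrow> 'a) \<Rightarrow> bool"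
  where "frobenius_extension A B \<phi> \<longleftrightarrow>
    ring_extension A B \<phi> \<and>
    fg_projective B (ring_bimod A id \<phi>) \<and>
    bimod_iso B A (ring_bimod A \<phi> id)
      (hom_bimod B (ring_bimod A id \<phi>) (ring_bimod B id id)) \<noteq> {}"

text \<open>
  \<open>A \<otimes>\<^sub>B A\<close> as an \<open>A\<close>-\<open>A\<close>-bimodule, and its multiplication map. Since the pure tensors generate
  \<open>A \<otimes>\<^sub>B A\<close>, the values of the multiplication map on pure tensors determine it on the carrier.
\<close>

definition self_tensor ::
  "('a, 'x) ring_scheme \<Rightarrow> ('b, 'y) ring_scheme \<Rightarrow> ('b \<Rightarrow> 'a) \<Rightarrow> (('a \<times> 'a \<Rightarrow>\<^sub>0 int) set, 'a, 'a) bimod"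
  where "self_tensor A B \<phi> = tensor_bimod B (ring_bimod A id \<phi>) (ring_bimod A \<phi> id)"

definition is_mult_map ::
  "('a, 'x) ring_scheme \<Rightarrow> ('b, 'y) ring_scheme \<Rightarrow> ('b \<Rightarrow> 'a) \<Rightarrow> (('a \<times> 'a \<Rightarrow>\<^sub>0 int) set \<Rightarrow> 'a) \<Rightarrow> bool"
  where "is_mult_map A B \<phi> \<mu> \<longleftrightarrow>
    \<mu> \<in> hom (self_tensor A B \<phi>) (add_monoid A) \<and>
    (\<forall>x\<in>carrier A. \<forall>y\<in>carrier A.
      \<mu> (pure_tensor B (ring_bimod A id \<phi>) (ring_bimod A \<phi> id) x y) = x \<otimes>\<^bsub>A\<^esub> y)"

definition separable_extension ::
  "('a, 'x) ring_scheme \<Rightarrow> ('b, 'y) ring_scheme \<Rightarrow> ('b \<Rightarrow> 'a) \<Rightarrow> bool"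
  where "separable_extension A B \<phi> \<longleftrightarrow>
    ring_extension A B \<phi> \<and>
    (\<exists>\<mu>. is_mult_map A B \<phi> \<mu> \<and> split_epi A A (self_tensor A B \<phi>) (ring_bimod A id id) \<mu>)"

definition separable_frobenius_extension ::
  "('a, 'x) ring_scheme \<Rightarrow> ('b, 'y) ring_scheme \<Rightarrow> ('b \<Rightarrow> 'a) \<Rightarrow> bool"
  where "separable_frobenius_extension A B \<phi> \<longleftrightarrow>
    frobenius_extension A B \<phi> \<and> separable_extension A B \<phi>"

text \<open>An algebra over a field \<open>R\<close> is given by its structure map \<open>\<eta>\<close> from \<open>R\<close> to the centre of \<open>A\<close>.\<close>

definition separable_frobenius_algebra ::
  "('r, 'y) ring_scheme \<Rightarrow> ('a, 'x) ring_scheme \<Rightarrow> ('r \<Rightarrow> 'a) \<Rightarrow> bool"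
  where "separable_frobenius_algebra R A \<eta> \<longleftrightarrow>
    field R \<and> (\<forall>r\<in>carrier R. \<forall>x\<in>carrier A. \<eta> r \<otimes>\<^bsub>A\<^esub> x = x \<otimes>\<^bsub>A\<^esub> \<eta> r) \<and>
    separable_frobenius_extension A R \<eta>"


section \<open>Centralizers and diagonalizable matrices\<close>

definition centralizer_ring :: "nat \<Rightarrow> 'r::comm_ring_1 mat \<Rightarrow> 'r mat ring"
  where "centralizer_ring n c =
    (ring_mat TYPE('r) n ()) \<lparr>carrier := {a \<in> carrier_mat n n. a * c = c * a}\<rparr>"

definition scalar_mat :: "nat \<Rightarrow> 'r::comm_ring_1 \<Rightarrow> 'r mat"
  where "scalar_mat n r = r \<cdot>\<^sub>m 1\<^sub>m n"

definition diagonalizable :: "'r::comm_ring_1 mat \<Rightarrow> bool"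
  where "diagonalizable c \<longleftrightarrow> (\<exists>d. diagonal_mat d \<and> similar_mat c d)"



end

theory Submission
  imports
    Defs
    "Jordan_Normal_Form.Char_Poly"
    "HOL-Algebra.Subrings"
begin

text \<open>
  Both directions rest on the separability element, an element \<open>\<Sum>\<^sub>i x\<^sub>i \<otimes> y\<^sub>i\<close> of \<open>A \<otimes>\<^sub>R A\<close> with
  \<open>\<Sum>\<^sub>i x\<^sub>i y\<^sub>i = 1\<close> that commutes with \<open>A\<close>; it is the value at \<open>1\<close> of a bimodule section of the multiplication
  map. Let \<open>A\<close> be the centralizer of \<open>c\<close>.

  If \<open>c\<close> is diagonalizable, then in an eigenbasis \<open>A\<close> is the algebra of block diagonal matrices, with one full
  matrix block per eigenvalue. The matrix units inside the blocks and the trace form a Frobenius system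
  (\<open>frobenius_extensionI\<close>), and \<open>\<Sum>\<^sub>j E\<^sub>j\<^sub>r \<otimes> E\<^sub>r\<^sub>j\<close>, where \<open>r\<close> is a chosen index in the block of \<open>j\<close>, is a separability
  element (\<open>separable_extensionI\<close>).

  Conversely, let \<open>A\<close> be separable. Then \<open>E m = \<Sum>\<^sub>i x\<^sub>i m y\<^sub>i\<close> averages an arbitrary matrix to one that commutes
  with \<open>A\<close> (\<open>separable_averaging\<close>). Take \<open>N = c - a\<close> for a scalar \<open>a\<close>, and write \<open>N = N M N\<close>, which is possible because
  matrix rings over a field are von Neumann regular (\<open>square_matrix_von_Neumann_regular\<close>). As \<open>N\<close> is central in
  \<open>A\<close>, averaging gives \<open>N = N E(M) N\<close>, where \<open>E(M)\<close> commutes with \<open>N\<close>. So the space is the direct sum of the kernel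
  and the image of \<open>c - a\<close>, for every \<open>a\<close>. Over an algebraically closed field this forces the eigenvectors to span: otherwise
  some left eigenvector of \<open>c\<close>, for an eigenvalue \<open>a\<close>, kills all eigenvectors; it then kills both summands and is
  zero (\<open>diagonalizable_if_group_inverses\<close>).
\<close>

section \<open>Tensor products of bimodules\<close>

text \<open>
  The closure conditions make the defining relators of the tensor product elements of the free abelian
  group on pairs.
\<close>

locale tensor_product =
  fixes B :: "('b, 'x) ring_scheme" and M :: "('m, 'b, 's, 'y) bimod_scheme"
    and N :: "('n, 't, 'b, 'z) bimod_scheme"
  assumes M_mult: "\<lbrakk>x \<in> carrier M; x' \<in> carrier M\<rbrakk> \<Longrightarrow> x \<otimes>\<^bsub>M\<^esub> x' \<in> carrier M"
    and M_ract: "\<lbrakk>x \<in> carrier M; b \<in> carrier B\<rbrakk> \<Longrightarrow> ract M x b \<in> carrier M"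
    and N_mult: "\<lbrakk>y \<in> carrier N; y' \<in> carrier N\<rbrakk> \<Longrightarrow> y \<otimes>\<^bsub>N\<^esub> y' \<in> carrier N"
    and N_lact: "\<lbrakk>b \<in> carrier B; y \<in> carrier N\<rbrakk> \<Longrightarrow> lact N b y \<in> carrier N"
begin

abbreviation F :: "('m \<times> 'n \<Rightarrow>\<^sub>0 int) monoid"
  where "F \<equiv> free_Abelian_group (carrier M \<times> carrier N)"

abbreviation K :: "('m \<times> 'n \<Rightarrow>\<^sub>0 int) set"
  where "K \<equiv> tensor_rel B M N"

abbreviation T :: "(('m \<times> 'n \<Rightarrow>\<^sub>0 int) set, 't, 's) bimod"
  where "T \<equiv> tensor_bimod B M N"

abbreviation pure :: "'m \<Rightarrow> 'n \<Rightarrow> ('m \<times> 'n \<Rightarrow>\<^sub>0 int) set"  (infixl \<open>\<otimes>\<^sub>T\<close> 70)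
  where "x \<otimes>\<^sub>T y \<equiv> pure_tensor B M N x y"

definition relators :: "('m \<times> 'n \<Rightarrow>\<^sub>0 int) set"
  where "relators =
    {frag_of (x \<otimes>\<^bsub>M\<^esub> x', y) - frag_of (x, y) - frag_of (x', y) | x x' y.
        x \<in> carrier M \<and> x' \<in> carrier M \<and> y \<in> carrier N} \<union>
    {frag_of (x, y \<otimes>\<^bsub>N\<^esub> y') - frag_of (x, y) - frag_of (x, y') | x y y'.
        x \<in> carrier M \<and> y \<in> carrier N \<and> y' \<in> carrier N} \<union>
    {frag_of (ract M x b, y) - frag_of (x, lact N b y) | x b y.
        x \<in> carrier M \<and> b \<in> carrier B \<and> y \<in> carrier N}"

lemma tensor_rel_eq_generate: "K = generate F relators"
  by (simp add: tensor_rel_def relators_def)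

sublocale F: comm_group F by (rule abelian_free_Abelian_group)

lemma diff_of_closed:
  assumes "a \<in> carrier F" "p \<in> carrier M \<times> carrier N" shows "a - frag_of p \<in> carrier F"
  using keys_diff[of a "frag_of p"] assms by auto

lemma relators_subset: "relators \<subseteq> carrier F"
  unfolding relators_def
  by (auto simp del: carrier_free_Abelian_group_iff
      intro!: diff_of_closed M_mult M_ract N_mult N_lact)

lemma K_subgroup: "subgroup K F"
  unfolding tensor_rel_eq_generate by (rule F.generate_is_subgroup[OF relators_subset])

lemma K_normal: "K \<lhd> F"
  by (rule F.subgroup_imp_normal[OF K_subgroup])

lemma K_zero: "0 \<in> K"
  using subgroup.one_closed[OF K_subgroup] by simp

lemma K_add: "a \<in> K \<Longrightarrow> b \<in> K \<Longrightarrow> a + b \<in> K"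
  using subgroup.m_closed[OF K_subgroup] by simp

lemma K_minimal:
  assumes "subgroup H F" "relators \<subseteq> H" shows "K \<subseteq> H"
  unfolding tensor_rel_eq_generate by (rule F.generate_subgroup_incl[OF assms(2,1)])

lemma T_simps:
  "carrier T = carrier (F Mod K)" "monoid.mult T = monoid.mult (F Mod K)" "one T = one (F Mod K)"
  "ract T X t = K <#>\<^bsub>F\<^esub> frag_extend (\<lambda>(x, y). frag_of (x, ract N y t)) ` X"
  "lact T s X = K <#>\<^bsub>F\<^esub> frag_extend (\<lambda>(x, y). frag_of (lact M s x, y)) ` X"
  by (simp_all add: tensor_bimod_def Let_def)

sublocale T: comm_group T
proof -
  interpret Q: comm_group "F Mod K" by (rule F.abelian_FactGroup[OF K_subgroup])
  show "comm_group T"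
    by (rule comm_groupI)
      (use Q.m_assoc Q.m_comm Q.l_inv_ex in \<open>simp_all add: T_simps(1-3) del: mult_FactGroup one_FactGroup\<close>)
qed

lemma hom_T: "hom T G = hom (F Mod K) G" "hom G T = hom G (F Mod K)"
  by (simp_all add: hom_def T_simps(1-3))

lemma coset_hom: "(\<lambda>z. K #>\<^bsub>F\<^esub> z) \<in> hom F T"
  unfolding hom_T by (rule normal.r_coset_hom_Mod[OF K_normal])

lemma coset_eqI:
  assumes "w \<in> carrier F" "z - w \<in> K" shows "K #>\<^bsub>F\<^esub> z = K #>\<^bsub>F\<^esub> w"
proof -
  have "z \<in> K #>\<^bsub>F\<^esub> w" unfolding r_coset_def using assms(2) by force
  then show ?thesis using F.repr_independence[OF _ assms(1) K_subgroup] by simp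
qed

lemma pure_closed: "\<lbrakk>x \<in> carrier M; y \<in> carrier N\<rbrakk> \<Longrightarrow> x \<otimes>\<^sub>T y \<in> carrier T"
  unfolding pure_tensor_def using hom_in_carrier[OF coset_hom] by simp

lemma coset_add:
  assumes "z \<in> carrier F" "w \<in> carrier F"
  shows "(K #>\<^bsub>F\<^esub> z) \<otimes>\<^bsub>T\<^esub> (K #>\<^bsub>F\<^esub> w) = K #>\<^bsub>F\<^esub> (z + w)"
  using hom_mult[OF coset_hom assms] by simp

lemma pure_add_left:
  assumes "x \<in> carrier M" "x' \<in> carrier M" "y \<in> carrier N"
  shows "(x \<otimes>\<^bsub>M\<^esub> x') \<otimes>\<^sub>T y = (x \<otimes>\<^sub>T y) \<otimes>\<^bsub>T\<^esub> (x' \<otimes>\<^sub>T y)"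
proof -
  have "frag_of (x \<otimes>\<^bsub>M\<^esub> x', y) - frag_of (x, y) - frag_of (x', y) \<in> K"
    unfolding tensor_rel_eq_generate by (rule generate.incl) (use assms in \<open>auto simp: relators_def\<close>)
  then show ?thesis
    unfolding pure_tensor_def using assms
    by (subst coset_add) (auto simp: diff_diff_eq intro!: coset_eqI F.m_closed[simplified mult_free_Abelian_group] simp del: carrier_free_Abelian_group_iff)
qed

lemma pure_add_right:
  assumes "x \<in> carrier M" "y \<in> carrier N" "y' \<in> carrier N"
  shows "x \<otimes>\<^sub>T (y \<otimes>\<^bsub>N\<^esub> y') = (x \<otimes>\<^sub>T y) \<otimes>\<^bsub>T\<^esub> (x \<otimes>\<^sub>T y')"
proof -
  have "frag_of (x, y \<otimes>\<^bsub>N\<^esub> y') - frag_of (x, y) - frag_of (x, y') \<in> K"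
    unfolding tensor_rel_eq_generate by (rule generate.incl) (use assms in \<open>auto simp: relators_def\<close>)
  then show ?thesis
    unfolding pure_tensor_def using assms
    by (subst coset_add) (auto simp: diff_diff_eq intro!: coset_eqI F.m_closed[simplified mult_free_Abelian_group] simp del: carrier_free_Abelian_group_iff)
qed

lemma pure_balanced:
  assumes "x \<in> carrier M" "b \<in> carrier B" "y \<in> carrier N"
  shows "ract M x b \<otimes>\<^sub>T y = x \<otimes>\<^sub>T lact N b y"
proof -
  have "frag_of (ract M x b, y) - frag_of (x, lact N b y) \<in> K"
    unfolding tensor_rel_eq_generate by (rule generate.incl) (use assms in \<open>auto simp: relators_def\<close>)
  then show ?thesis
    unfolding pure_tensor_def using assms N_lact by (auto intro!: coset_eqI)
qed

text \<open>
  The free abelian group is generated by the pairs, so a homomorphism out of its quotient is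
  determined by the pure tensors.
\<close>

lemma hom_eqI:
  assumes f: "f \<in> hom T G" and g: "g \<in> hom T G" and G: "group G"
    and eq: "\<And>x y. \<lbrakk>x \<in> carrier M; y \<in> carrier N\<rbrakk> \<Longrightarrow> f (x \<otimes>\<^sub>T y) = g (x \<otimes>\<^sub>T y)"
    and X: "X \<in> carrier T"
  shows "f X = g X"
proof -
  interpret G: group G by (rule G)
  define f' g' where "f' = f \<circ> (\<lambda>z. K #>\<^bsub>F\<^esub> z)" and "g' = g \<circ> (\<lambda>z. K #>\<^bsub>F\<^esub> z)"
  interpret f': group_hom F G f'
    by unfold_locales (use hom_compose[OF coset_hom f] in \<open>simp add: f'_def\<close>)
  interpret g': group_hom F G g'
    by unfold_locales (use hom_compose[OF coset_hom g] in \<open>simp add: g'_def\<close>)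
  have "f' z = g' z" if "Poly_Mapping.keys z \<subseteq> carrier M \<times> carrier N" for z
    using that
  proof (induction rule: free_Abelian_group_induct[consumes 1, case_names zero diff of])
    case (of p)
    then show ?case using eq by (cases p) (auto simp: f'_def g'_def pure_tensor_def)
  next
    case (diff z w)
    have "z - w = z \<otimes>\<^bsub>F\<^esub> inv\<^bsub>F\<^esub> w" using diff by simp
    then show ?case
      using diff f'.hom_mult[of z "inv\<^bsub>F\<^esub> w"] g'.hom_mult[of z "inv\<^bsub>F\<^esub> w"] f'.hom_inv[of w] g'.hom_inv[of w]
      by simp
  qed (use f'.hom_one g'.hom_one in simp)
  moreover obtain z where "z \<in> carrier F" "X = K #>\<^bsub>F\<^esub> z"
    using X by (auto simp: T_simps carrier_FactGroup)
  ultimately show ?thesis by (auto simp: f'_def g'_def)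
qed

text \<open>
  The universal property: the extension of \<open>\<beta>\<close> to the free abelian group kills the relators exactly
  because \<open>\<beta>\<close> is biadditive and balanced.
\<close>

lemma lift:
  assumes G: "comm_group G"
    and closed: "\<And>x y. \<lbrakk>x \<in> carrier M; y \<in> carrier N\<rbrakk> \<Longrightarrow> \<beta> x y \<in> carrier G"
    and add_left: "\<And>x x' y. \<lbrakk>x \<in> carrier M; x' \<in> carrier M; y \<in> carrier N\<rbrakk>
      \<Longrightarrow> \<beta> (x \<otimes>\<^bsub>M\<^esub> x') y = \<beta> x y \<otimes>\<^bsub>G\<^esub> \<beta> x' y"
    and add_right: "\<And>x y y'. \<lbrakk>x \<in> carrier M; y \<in> carrier N; y' \<in> carrier N\<rbrakk>
      \<Longrightarrow> \<beta> x (y \<otimes>\<^bsub>N\<^esub> y') = \<beta> x y \<otimes>\<^bsub>G\<^esub> \<beta> x y'"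
    and balanced: "\<And>x b y. \<lbrakk>x \<in> carrier M; b \<in> carrier B; y \<in> carrier N\<rbrakk>
      \<Longrightarrow> \<beta> (ract M x b) y = \<beta> x (lact N b y)"
  obtains h where "h \<in> hom T G"
    "\<And>x y. \<lbrakk>x \<in> carrier M; y \<in> carrier N\<rbrakk> \<Longrightarrow> h (x \<otimes>\<^sub>T y) = \<beta> x y"
proof -
  interpret G: comm_group G by (rule G)
  obtain h where h: "h \<in> hom F G"
    and h_of: "\<And>p. p \<in> carrier M \<times> carrier N \<Longrightarrow> h (frag_of p) = case_prod \<beta> p"
    using G.free_Abelian_group_universal[of "case_prod \<beta>" "carrier M \<times> carrier N"] closed
    by (metis (mono_tags, lifting) SigmaE image_subsetI old.prod.case)
  interpret h: group_hom F G h by unfold_locales (rule h)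
  have h_diff: "h (z - w) = h z \<otimes>\<^bsub>G\<^esub> inv\<^bsub>G\<^esub> h w"
    if "z \<in> carrier F" "w \<in> carrier F" for z w
    using that h.hom_mult[of z "inv\<^bsub>F\<^esub> w"] h.hom_inv[of w] by simp
  have cancel: "a \<otimes>\<^bsub>G\<^esub> b \<otimes>\<^bsub>G\<^esub> inv\<^bsub>G\<^esub> a \<otimes>\<^bsub>G\<^esub> inv\<^bsub>G\<^esub> b = \<one>\<^bsub>G\<^esub>"
    if "a \<in> carrier G" "b \<in> carrier G" for a b
    using that G.r_inv[of "a \<otimes>\<^bsub>G\<^esub> b"] by (simp add: G.m_assoc G.inv_mult)
  have sub: "relators \<subseteq> kernel F G h"
  proof
    fix r assume r: "r \<in> relators"
    have "h r = \<one>\<^bsub>G\<^esub>"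
      using r unfolding relators_def
      by (auto simp: h_diff h_of diff_of_closed M_mult M_ract N_mult N_lact closed add_left add_right
          balanced cancel simp del: carrier_free_Abelian_group_iff)
    then show "r \<in> kernel F G h" using subsetD[OF relators_subset r] by (simp add: kernel_def)
  qed
  have "K \<subseteq> kernel F G h" by (rule K_minimal[OF h.subgroup_kernel sub])
  then obtain g where g: "g \<in> hom (F Mod K) G" "\<And>z. z \<in> carrier F \<Longrightarrow> g (K #>\<^bsub>F\<^esub> z) = h z"
    using h.FactGroup_universal_kernel[OF K_normal] by blast
  show ?thesis
  proof
    show "g \<in> hom T G" using g(1) by (simp add: hom_T)
    show "g (x \<otimes>\<^sub>T y) = \<beta> x y" if "x \<in> carrier M" "y \<in> carrier N" for x y
      unfolding pure_tensor_def using that g(2) h_of by simp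
  qed
qed

text \<open>
  The maps \<open>\<phi> \<otimes> \<psi>\<close> in the coset form in which the two actions on a tensor product are defined. The
  induced endomorphism \<open>f\<close> of the free abelian group sends each relator to a relator of the same kind,
  hence preserves \<open>K\<close> and acts on cosets.
\<close>

lemma functorial:
  assumes \<phi>: "\<phi> \<in> rmod_hom B M M" and \<psi>: "\<psi> \<in> hom N N"
    and \<psi>_lact: "\<And>b y. \<lbrakk>b \<in> carrier B; y \<in> carrier N\<rbrakk> \<Longrightarrow> \<psi> (lact N b y) = lact N b (\<psi> y)"
  defines "f \<equiv> frag_extend (\<lambda>(x, y). frag_of (\<phi> x, \<psi> y))"
  shows "(\<lambda>X. K <#>\<^bsub>F\<^esub> f ` X) \<in> hom T T"
    and "K <#>\<^bsub>F\<^esub> f ` (x \<otimes>\<^sub>T y) = \<phi> x \<otimes>\<^sub>T \<psi> y"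
proof -
  have \<phi>_closed: "\<phi> x \<in> carrier M" if "x \<in> carrier M" for x
    using that \<phi> hom_in_carrier by (auto simp: rmod_hom_def)
  have \<psi>_closed: "\<psi> y \<in> carrier N" if "y \<in> carrier N" for y
    using that hom_in_carrier[OF \<psi>] by simp
  have f_add: "f (z + w) = f z + f w" and f_diff: "f (z - w) = f z - f w" for z w
    by (simp_all add: f_def frag_extend_add frag_extend_diff)
  have f_closed: "f z \<in> carrier F" if "z \<in> carrier F" for z
    using that keys_frag_extend[of "\<lambda>(x, y). frag_of (\<phi> x, \<psi> y)" z] \<phi>_closed \<psi>_closed
    unfolding f_def by fastforce
  have f_hom: "f \<in> hom F F" using f_closed f_add by (auto simp: hom_def)
  interpret f: group_hom F F f by unfold_locales (rule f_hom)
  have "subgroup {z \<in> carrier F. f z \<in> K} F"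
  proof (rule F.subgroupI)
    show "{z \<in> carrier F. f z \<in> K} \<noteq> {}" using K_zero f.hom_one by force
  next
    fix z assume "z \<in> {z \<in> carrier F. f z \<in> K}"
    then show "inv\<^bsub>F\<^esub> z \<in> {z \<in> carrier F. f z \<in> K}"
      using subgroup.m_inv_closed[OF K_subgroup] F.inv_closed[of z] f.hom_inv[of z] by auto
  next
    fix z w assume "z \<in> {z \<in> carrier F. f z \<in> K}" "w \<in> {z \<in> carrier F. f z \<in> K}"
    then show "z \<otimes>\<^bsub>F\<^esub> w \<in> {z \<in> carrier F. f z \<in> K}"
      using subgroup.m_closed[OF K_subgroup] F.m_closed[of z w] f.hom_mult[of z w] by auto
  qed auto
  moreover have "f r \<in> relators" if "r \<in> relators" for r
  proof -
    have mult: "\<phi> (x \<otimes>\<^bsub>M\<^esub> x') = \<phi> x \<otimes>\<^bsub>M\<^esub> \<phi> x'" if "x \<in> carrier M" "x' \<in> carrier M" for x x'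
      using \<phi> that by (simp add: rmod_hom_def hom_mult)
    have act: "\<phi> (ract M x b) = ract M (\<phi> x) b" if "x \<in> carrier M" "b \<in> carrier B" for x b
      using \<phi> that by (simp add: rmod_hom_def)
    show ?thesis
      using that unfolding relators_def f_def frag_extend_diff
      apply (elim UnE)
      subgoal by (rule UnI1, rule UnI1) (force simp: mult \<phi>_closed \<psi>_closed frag_extend_diff)
      subgoal by (rule UnI1, rule UnI2) (force simp: hom_mult[OF \<psi>] \<phi>_closed \<psi>_closed frag_extend_diff)
      subgoal by (rule UnI2) (force simp: act \<psi>_lact \<phi>_closed \<psi>_closed frag_extend_diff)
      done
  qed
  then have "relators \<subseteq> {z \<in> carrier F. f z \<in> K}"
    using relators_subset generate.incl unfolding tensor_rel_eq_generate by fast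
  ultimately have f_K: "f k \<in> K" if "k \<in> K" for k using K_minimal that by blast
  have coset: "K <#>\<^bsub>F\<^esub> f ` (K #>\<^bsub>F\<^esub> z) = K #>\<^bsub>F\<^esub> f z" for z
  proof
    show "K <#>\<^bsub>F\<^esub> f ` (K #>\<^bsub>F\<^esub> z) \<subseteq> K #>\<^bsub>F\<^esub> f z"
      using K_add f_K by (auto simp: set_mult_def r_coset_def f_add simp flip: add.assoc)
    have "k + f z \<in> K <#>\<^bsub>F\<^esub> f ` (K #>\<^bsub>F\<^esub> z)" if "k \<in> K" for k
      using that K_zero unfolding set_mult_def r_coset_def by force
    then show "K #>\<^bsub>F\<^esub> f z \<subseteq> K <#>\<^bsub>F\<^esub> f ` (K #>\<^bsub>F\<^esub> z)" by (auto simp: r_coset_def)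
  qed
  show "K <#>\<^bsub>F\<^esub> f ` (x \<otimes>\<^sub>T y) = \<phi> x \<otimes>\<^sub>T \<psi> y"
    unfolding pure_tensor_def coset by (simp add: f_def)
  show "(\<lambda>X. K <#>\<^bsub>F\<^esub> f ` X) \<in> hom T T"
  proof (rule homI)
    fix X assume "X \<in> carrier T"
    then obtain z where z: "z \<in> carrier F" "X = K #>\<^bsub>F\<^esub> z" by (auto simp: T_simps carrier_FactGroup)
    show "K <#>\<^bsub>F\<^esub> f ` X \<in> carrier T"
      unfolding z(2) coset by (rule hom_in_carrier[OF coset_hom f_closed[OF z(1)]])
    fix Y assume "Y \<in> carrier T"
    then obtain w where w: "w \<in> carrier F" "Y = K #>\<^bsub>F\<^esub> w" by (auto simp: T_simps carrier_FactGroup)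
    show "K <#>\<^bsub>F\<^esub> f ` (X \<otimes>\<^bsub>T\<^esub> Y) = (K <#>\<^bsub>F\<^esub> f ` X) \<otimes>\<^bsub>T\<^esub> (K <#>\<^bsub>F\<^esub> f ` Y)"
      unfolding z(2) w(2) coset_add[OF z(1) w(1)] coset
      by (simp add: coset_add f_closed z w f_add del: carrier_free_Abelian_group_iff)
  qed
qed

end

section \<open>Frobenius systems\<close>

lemma ring_bimod_simps [simp]:
  "carrier (ring_bimod A \<phi> \<psi>) = carrier A"
  "x \<otimes>\<^bsub>ring_bimod A \<phi> \<psi>\<^esub> y = x \<oplus>\<^bsub>A\<^esub> y"
  "\<one>\<^bsub>ring_bimod A \<phi> \<psi>\<^esub> = \<zero>\<^bsub>A\<^esub>"
  "ract (ring_bimod A \<phi> \<psi>) x t = x \<otimes>\<^bsub>A\<^esub> \<psi> t"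
  "lact (ring_bimod A \<phi> \<psi>) s x = \<phi> s \<otimes>\<^bsub>A\<^esub> x"
  by (simp_all add: ring_bimod_def)

lemma finprod_hom:
  assumes G: "comm_group G" and H: "comm_group H" and f: "f \<in> hom G H" and g: "g \<in> I \<rightarrow> carrier G"
  shows "f (finprod G g I) = finprod H (\<lambda>i. f (g i)) I"
proof -
  interpret G: comm_group G by (rule G)
  interpret H: comm_group H by (rule H)
  interpret f: group_hom G H f by unfold_locales (rule f)
  show ?thesis
  proof (cases "finite I")
    case True
    then show ?thesis using g
    proof induction
      case (insert i I)
      then have "g \<in> I \<rightarrow> carrier G" "g i \<in> carrier G" by auto
      moreover then have "(\<lambda>i. f (g i)) \<in> I \<rightarrow> carrier H" "f (g i) \<in> carrier H"
        by (auto intro: hom_in_carrier[OF f])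
      ultimately show ?case using insert by simp
    qed simp
  qed simp
qed

lemma (in comm_monoid) finprod_swap:
  assumes "finite I" "finite J" and f: "\<And>i j. i \<in> I \<Longrightarrow> j \<in> J \<Longrightarrow> f i j \<in> carrier G"
  shows "finprod G (\<lambda>i. finprod G (f i) J) I = finprod G (\<lambda>j. finprod G (\<lambda>i. f i j) I) J"
  using assms(1) f
proof induction
  case (insert i I)
  have "finprod G (\<lambda>i. finprod G (f i) J) (insert i I)
      = finprod G (f i) J \<otimes> finprod G (\<lambda>i. finprod G (f i) J) I"
    using insert by (intro finprod_insert) (auto intro!: finprod_closed)
  also have "\<dots> = finprod G (f i) J \<otimes> finprod G (\<lambda>j. finprod G (\<lambda>i. f i j) I) J"
    using insert by simp
  also have "\<dots> = finprod G (\<lambda>j. f i j \<otimes> finprod G (\<lambda>i. f i j) I) J"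
    by (rule finprod_multf[symmetric]) (use insert in \<open>auto intro!: finprod_closed\<close>)
  also have "\<dots> = finprod G (\<lambda>j. finprod G (\<lambda>i. f i j) (insert i I)) J"
    by (rule finprod_cong') (use insert in \<open>auto intro!: finprod_closed finprod_insert[symmetric]\<close>)
  finally show ?case .
qed simp

locale extension = A: ring A + B: ring B
  for A :: "('a, 'x) ring_scheme" and B :: "('b, 'y) ring_scheme" +
  fixes \<phi> :: "'b \<Rightarrow> 'a"
  assumes \<phi>: "\<phi> \<in> Ring.ring_hom B A"
begin

lemma is_ring_extension: "ring_extension A B \<phi>"
  unfolding ring_extension_def using A.ring_axioms B.ring_axioms \<phi> by simp

lemma \<phi>_closed [simp]: "b \<in> carrier B \<Longrightarrow> \<phi> b \<in> carrier A"
  by (rule ring_hom_closed[OF \<phi>])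

lemmas \<phi>_mult = ring_hom_mult[OF \<phi>]

text \<open>
  The first expansion is a dual basis of \<open>A\<close> as a right
  \<open>B\<close>-module, with coordinate functions \<open>x \<mapsto> \<tau> (v\<^sub>i x)\<close>, so \<open>A\<close> is a direct summand of \<open>B\<^sup>I\<close>. The bimodule
  isomorphism sends \<open>a\<close> to \<open>x \<mapsto> \<tau> (a x)\<close>; its inverse is \<open>f \<mapsto> \<Sum>\<^sub>i f(u\<^sub>i) v\<^sub>i\<close>, where one composite is the
  identity by the second expansion and the other one by the first.
\<close>

lemma frobenius_extensionI:
  assumes fin: "finite I" and u: "\<And>i. i \<in> I \<Longrightarrow> u i \<in> carrier A" and v: "\<And>i. i \<in> I \<Longrightarrow> v i \<in> carrier A"
    and \<tau>: "\<tau> \<in> bimod_hom B B (ring_bimod A \<phi> \<phi>) (ring_bimod B id id)"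
    and expand_left: "\<And>x. x \<in> carrier A \<Longrightarrow> (\<Oplus>\<^bsub>A\<^esub>i\<in>I. u i \<otimes>\<^bsub>A\<^esub> \<phi> (\<tau> (v i \<otimes>\<^bsub>A\<^esub> x))) = x"
    and expand_right: "\<And>x. x \<in> carrier A \<Longrightarrow> (\<Oplus>\<^bsub>A\<^esub>i\<in>I. \<phi> (\<tau> (x \<otimes>\<^bsub>A\<^esub> u i)) \<otimes>\<^bsub>A\<^esub> v i) = x"
  shows "frobenius_extension A B \<phi>"
proof -
  have \<tau>_closed [simp]: "\<tau> x \<in> carrier B" if "x \<in> carrier A" for x
    using \<tau> that by (auto simp: bimod_hom_def rmod_hom_def ring_bimod_def hom_def)
  have \<tau>_add: "\<tau> (x \<oplus>\<^bsub>A\<^esub> y) = \<tau> x \<oplus>\<^bsub>B\<^esub> \<tau> y" if "x \<in> carrier A" "y \<in> carrier A" for x y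
    using \<tau> that by (auto simp: bimod_hom_def rmod_hom_def ring_bimod_def hom_def)
  have \<tau>_ract: "\<tau> (x \<otimes>\<^bsub>A\<^esub> \<phi> b) = \<tau> x \<otimes>\<^bsub>B\<^esub> b" if "x \<in> carrier A" "b \<in> carrier B" for x b
    using \<tau> that by (auto simp: bimod_hom_def rmod_hom_def ring_bimod_def)
  have \<tau>_lact: "\<tau> (\<phi> b \<otimes>\<^bsub>A\<^esub> x) = b \<otimes>\<^bsub>B\<^esub> \<tau> x" if "x \<in> carrier A" "b \<in> carrier B" for x b
    using \<tau> that by (auto simp: bimod_hom_def ring_bimod_def)
  have hom_finsum: "f (\<Oplus>\<^bsub>A\<^esub>i\<in>J. g i) = (\<Oplus>\<^bsub>B\<^esub>i\<in>J. f (g i))"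
    if "f \<in> hom (add_monoid A) (add_monoid B)" "g \<in> J \<rightarrow> carrier A" for f g and J :: "'c set"
    unfolding finsum_def using that by (intro finprod_hom A.a_comm_group B.a_comm_group) auto
  have \<tau>_hom: "\<tau> \<in> hom (add_monoid A) (add_monoid B)" by (auto simp: hom_def \<tau>_add)

  have "fg_projective B (ring_bimod A id \<phi>)"
  proof -
    obtain h where h: "bij_betw h {..<card I} I"
      using ex_bij_betw_nat_finite[OF fin] by (auto simp: lessThan_atLeast0)
    let ?m = "card I"
    have h_in: "h k \<in> I" if "k < ?m" for k using h that by (auto simp: bij_betw_def)
    \<comment> \<open>Free modules are indexed by an initial segment of the naturals, so \<open>I\<close> is enumerated by \<open>h\<close>.\<close>
    define \<iota> where "\<iota> x = (\<lambda>k\<in>{..<?m}. \<tau> (v (h k) \<otimes>\<^bsub>A\<^esub> x))" for x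
    define \<pi> where "\<pi> c = (\<Oplus>\<^bsub>A\<^esub>k\<in>{..<?m}. u (h k) \<otimes>\<^bsub>A\<^esub> \<phi> (c k))" for c
    have "\<iota> \<in> rmod_hom B (ring_bimod A id \<phi>) (free_rmod B ?m)"
      by (auto simp: rmod_hom_def hom_def ring_bimod_def free_rmod_def \<iota>_def h_in v A.r_distr \<tau>_add
          simp flip: A.m_assoc intro!: restrict_ext \<tau>_ract)
    moreover have "\<pi> \<in> rmod_hom B (free_rmod B ?m) (ring_bimod A id \<phi>)"
      unfolding rmod_hom_def hom_def
    proof (intro CollectI conjI ballI funcsetI)
      fix c assume "c \<in> carrier (free_rmod B ?m)"
      then have c: "c k \<in> carrier B" if "k < ?m" for k using that by (auto simp: free_rmod_def)
      show "\<pi> c \<in> carrier (ring_bimod A id \<phi>)"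
        by (auto simp: ring_bimod_def \<pi>_def c h_in u intro!: A.finsum_closed)
      show "\<pi> (ract (free_rmod B ?m) c t) = ract (ring_bimod A id \<phi>) (\<pi> c) t"
        if "t \<in> carrier B" for t
      proof -
        have "\<pi> (ract (free_rmod B ?m) c t) = (\<Oplus>\<^bsub>A\<^esub>k\<in>{..<?m}. u (h k) \<otimes>\<^bsub>A\<^esub> \<phi> (c k) \<otimes>\<^bsub>A\<^esub> \<phi> t)"
          unfolding \<pi>_def
          by (rule A.finsum_cong') (auto simp: free_rmod_def that c h_in u \<phi>_mult A.m_assoc)
        also have "\<dots> = \<pi> c \<otimes>\<^bsub>A\<^esub> \<phi> t"
          unfolding \<pi>_def by (rule A.finsum_ldistr[symmetric]) (auto simp: that c h_in u)
        finally show ?thesis by (simp add: ring_bimod_def)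
      qed
      fix d assume "d \<in> carrier (free_rmod B ?m)"
      then have d: "d k \<in> carrier B" if "k < ?m" for k using that by (auto simp: free_rmod_def)
      have "\<pi> (c \<otimes>\<^bsub>free_rmod B ?m\<^esub> d)
          = (\<Oplus>\<^bsub>A\<^esub>k\<in>{..<?m}. u (h k) \<otimes>\<^bsub>A\<^esub> \<phi> (c k) \<oplus>\<^bsub>A\<^esub> u (h k) \<otimes>\<^bsub>A\<^esub> \<phi> (d k))"
        unfolding \<pi>_def
        by (rule A.finsum_cong') (auto simp: free_rmod_def c d h_in u ring_hom_add[OF \<phi>] A.r_distr)
      also have "\<dots> = \<pi> c \<oplus>\<^bsub>A\<^esub> \<pi> d"
        unfolding \<pi>_def by (rule A.finsum_addf) (auto simp: c d h_in u)
      finally show "\<pi> (c \<otimes>\<^bsub>free_rmod B ?m\<^esub> d) = \<pi> c \<otimes>\<^bsub>ring_bimod A id \<phi>\<^esub> \<pi> d"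
        by (simp add: ring_bimod_def)
    qed
    moreover have "\<pi> (\<iota> x) = x" if x: "x \<in> carrier A" for x
    proof -
      have "\<pi> (\<iota> x) = (\<Oplus>\<^bsub>A\<^esub>k\<in>{..<?m}. u (h k) \<otimes>\<^bsub>A\<^esub> \<phi> (\<tau> (v (h k) \<otimes>\<^bsub>A\<^esub> x)))"
        unfolding \<pi>_def by (rule A.finsum_cong') (auto simp: \<iota>_def x h_in u v)
      also have "\<dots> = (\<Oplus>\<^bsub>A\<^esub>i\<in>h ` {..<?m}. u i \<otimes>\<^bsub>A\<^esub> \<phi> (\<tau> (v i \<otimes>\<^bsub>A\<^esub> x)))"
        by (rule A.finsum_reindex[symmetric]) (use h h_in in \<open>auto simp: bij_betw_def x u v\<close>)
      finally show ?thesis using h expand_left x by (simp add: bij_betw_def)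
    qed
    ultimately show ?thesis unfolding fg_projective_def
      by (intro exI[of _ ?m] bexI[of _ \<iota>] bexI[of _ \<pi>]) (auto simp: ring_bimod_def)
  qed
  moreover
  let ?H = "hom_bimod B (ring_bimod A id \<phi>) (ring_bimod B id id)"
  define \<Theta> where "\<Theta> a = (\<lambda>x\<in>carrier A. \<tau> (a \<otimes>\<^bsub>A\<^esub> x))" for a
  have \<Theta>_carrier: "\<Theta> a \<in> carrier ?H" if "a \<in> carrier A" for a
    using that by (auto simp: \<Theta>_def hom_bimod_def rmod_hom_def hom_def ring_bimod_def A.r_distr \<tau>_add
        \<tau>_ract simp flip: A.m_assoc)
  have "\<Theta> \<in> bimod_hom B A (ring_bimod A \<phi> id) ?H"
    unfolding bimod_hom_def rmod_hom_def hom_def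
  proof (intro CollectI conjI ballI funcsetI)
    show "\<Theta> a \<in> carrier ?H" if "a \<in> carrier (ring_bimod A \<phi> id)" for a
      using that \<Theta>_carrier by (simp add: ring_bimod_def)
  qed (auto simp: \<Theta>_def hom_bimod_def ring_bimod_def A.l_distr \<tau>_add A.m_assoc \<tau>_lact intro!: restrict_ext)
  moreover have "bij_betw \<Theta> (carrier (ring_bimod A \<phi> id)) (carrier ?H)"
  proof (rule bij_betwI[of _ _ _ "\<lambda>f. \<Oplus>\<^bsub>A\<^esub>i\<in>I. \<phi> (f (u i)) \<otimes>\<^bsub>A\<^esub> v i"])
    show "\<Theta> \<in> carrier (ring_bimod A \<phi> id) \<rightarrow> carrier ?H"
      using \<Theta>_carrier by (simp add: ring_bimod_def)
    show "(\<Oplus>\<^bsub>A\<^esub>i\<in>I. \<phi> (\<Theta> a (u i)) \<otimes>\<^bsub>A\<^esub> v i) = a" if "a \<in> carrier (ring_bimod A \<phi> id)" for a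
    proof -
      have a: "a \<in> carrier A" using that by (simp add: ring_bimod_def)
      have "(\<Oplus>\<^bsub>A\<^esub>i\<in>I. \<phi> (\<Theta> a (u i)) \<otimes>\<^bsub>A\<^esub> v i) = (\<Oplus>\<^bsub>A\<^esub>i\<in>I. \<phi> (\<tau> (a \<otimes>\<^bsub>A\<^esub> u i)) \<otimes>\<^bsub>A\<^esub> v i)"
        by (rule A.finsum_cong') (auto simp: \<Theta>_def u v a)
      then show ?thesis using expand_right a by simp
    qed
    have closed: "f x \<in> carrier B" if "f \<in> carrier ?H" "x \<in> carrier A" for f x
      using that by (auto simp: hom_bimod_def rmod_hom_def hom_def ring_bimod_def)
    show "(\<lambda>f. \<Oplus>\<^bsub>A\<^esub>i\<in>I. \<phi> (f (u i)) \<otimes>\<^bsub>A\<^esub> v i) \<in> carrier ?H \<rightarrow> carrier (ring_bimod A \<phi> id)"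
      by (auto simp: ring_bimod_def[of A \<phi> id] closed u v intro!: A.finsum_closed)
    show "\<Theta> (\<Oplus>\<^bsub>A\<^esub>i\<in>I. \<phi> (f (u i)) \<otimes>\<^bsub>A\<^esub> v i) = f" if f: "f \<in> carrier ?H" for f
    proof (rule extensionalityI[of _ "carrier A"])
      show "\<Theta> (\<Oplus>\<^bsub>A\<^esub>i\<in>I. \<phi> (f (u i)) \<otimes>\<^bsub>A\<^esub> v i) \<in> extensional (carrier A)"
        by (simp add: \<Theta>_def)
      show "f \<in> extensional (carrier A)" using f by (simp add: hom_bimod_def ring_bimod_def)
      fix x assume x: "x \<in> carrier A"
      have f_hom: "f \<in> hom (add_monoid A) (add_monoid B)"
        using f by (auto simp: hom_bimod_def rmod_hom_def hom_def ring_bimod_def)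
      have f_ract: "f (a \<otimes>\<^bsub>A\<^esub> \<phi> b) = f a \<otimes>\<^bsub>B\<^esub> b" if "a \<in> carrier A" "b \<in> carrier B" for a b
        using f that by (auto simp: hom_bimod_def rmod_hom_def ring_bimod_def)
      have "(\<Oplus>\<^bsub>A\<^esub>i\<in>I. \<phi> (f (u i)) \<otimes>\<^bsub>A\<^esub> v i) \<otimes>\<^bsub>A\<^esub> x
          = (\<Oplus>\<^bsub>A\<^esub>i\<in>I. \<phi> (f (u i)) \<otimes>\<^bsub>A\<^esub> v i \<otimes>\<^bsub>A\<^esub> x)"
        by (rule A.finsum_ldistr[OF fin x]) (auto simp: closed f u v)
      also have "\<dots> = (\<Oplus>\<^bsub>A\<^esub>i\<in>I. \<phi> (f (u i)) \<otimes>\<^bsub>A\<^esub> (v i \<otimes>\<^bsub>A\<^esub> x))"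
        by (rule A.finsum_cong') (auto simp: closed f u v x A.m_assoc)
      finally have "\<Theta> (\<Oplus>\<^bsub>A\<^esub>i\<in>I. \<phi> (f (u i)) \<otimes>\<^bsub>A\<^esub> v i) x = \<tau> (\<Oplus>\<^bsub>A\<^esub>i\<in>I. \<phi> (f (u i)) \<otimes>\<^bsub>A\<^esub> (v i \<otimes>\<^bsub>A\<^esub> x))"
        using x by (simp add: \<Theta>_def)
      also have "\<dots> = (\<Oplus>\<^bsub>B\<^esub>i\<in>I. \<tau> (\<phi> (f (u i)) \<otimes>\<^bsub>A\<^esub> (v i \<otimes>\<^bsub>A\<^esub> x)))"
        by (rule hom_finsum[OF \<tau>_hom]) (auto simp: closed f u v x)
      also have "\<dots> = (\<Oplus>\<^bsub>B\<^esub>i\<in>I. f (u i \<otimes>\<^bsub>A\<^esub> \<phi> (\<tau> (v i \<otimes>\<^bsub>A\<^esub> x))))"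
        by (rule B.finsum_cong') (auto simp: closed f u v x \<tau>_lact f_ract)
      also have "\<dots> = f (\<Oplus>\<^bsub>A\<^esub>i\<in>I. u i \<otimes>\<^bsub>A\<^esub> \<phi> (\<tau> (v i \<otimes>\<^bsub>A\<^esub> x)))"
        by (rule hom_finsum[OF f_hom, symmetric]) (auto simp: u v x)
      finally show "\<Theta> (\<Oplus>\<^bsub>A\<^esub>i\<in>I. \<phi> (f (u i)) \<otimes>\<^bsub>A\<^esub> v i) x = f x" using expand_left x by simp
    qed
  qed
  ultimately show ?thesis
    unfolding frobenius_extension_def bimod_iso_def using is_ring_extension by blast
qed

end

section \<open>Separability elements\<close>

context extension
begin

sublocale AA: tensor_product B "ring_bimod A id \<phi>" "ring_bimod A \<phi> id"
  by unfold_locales auto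

lemma self_tensor_eq: "self_tensor A B \<phi> = AA.T"
  by (simp add: self_tensor_def)

lemma lact_hom:
  assumes s: "s \<in> carrier A"
  shows "lact AA.T s \<in> hom AA.T AA.T"
    and "lact AA.T s (AA.pure x y) = AA.pure (s \<otimes>\<^bsub>A\<^esub> x) y"
proof -
  have eq: "lact AA.T s = (\<lambda>X. AA.K <#>\<^bsub>AA.F\<^esub> frag_extend (\<lambda>(x, y). frag_of (s \<otimes>\<^bsub>A\<^esub> x, y)) ` X)"
    by (rule ext) (simp add: AA.T_simps)
  have mult: "(\<lambda>x. s \<otimes>\<^bsub>A\<^esub> x) \<in> rmod_hom B (ring_bimod A id \<phi>) (ring_bimod A id \<phi>)"
    using s by (auto simp: rmod_hom_def hom_def A.r_distr A.m_assoc)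
  have id: "(\<lambda>y. y) \<in> hom (ring_bimod A \<phi> id) (ring_bimod A \<phi> id)" by (simp add: hom_def)
  note * = AA.functorial[OF mult id refl]
  show "lact AA.T s \<in> hom AA.T AA.T" unfolding eq by (rule *(1))
  show "lact AA.T s (AA.pure x y) = AA.pure (s \<otimes>\<^bsub>A\<^esub> x) y" unfolding eq by (rule *(2))
qed

lemma ract_hom:
  assumes t: "t \<in> carrier A"
  shows "(\<lambda>X. ract AA.T X t) \<in> hom AA.T AA.T"
    and "ract AA.T (AA.pure x y) t = AA.pure x (y \<otimes>\<^bsub>A\<^esub> t)"
proof -
  have eq: "ract AA.T X t = AA.K <#>\<^bsub>AA.F\<^esub> frag_extend (\<lambda>(x, y). frag_of (x, y \<otimes>\<^bsub>A\<^esub> t)) ` X" for X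
    by (simp add: AA.T_simps)
  have id: "(\<lambda>x. x) \<in> rmod_hom B (ring_bimod A id \<phi>) (ring_bimod A id \<phi>)"
    by (simp add: rmod_hom_def hom_def)
  have mult: "(\<lambda>y. y \<otimes>\<^bsub>A\<^esub> t) \<in> hom (ring_bimod A \<phi> id) (ring_bimod A \<phi> id)"
    using t by (auto simp: hom_def A.l_distr)
  have bal: "lact (ring_bimod A \<phi> id) b y \<otimes>\<^bsub>A\<^esub> t = lact (ring_bimod A \<phi> id) b (y \<otimes>\<^bsub>A\<^esub> t)"
    if "b \<in> carrier B" "y \<in> carrier (ring_bimod A \<phi> id)" for b y
    using that t by (simp add: A.m_assoc)
  note * = AA.functorial[OF id mult bal]
  show "(\<lambda>X. ract AA.T X t) \<in> hom AA.T AA.T" unfolding eq by (rule *(1))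
  show "ract AA.T (AA.pure x y) t = AA.pure x (y \<otimes>\<^bsub>A\<^esub> t)" unfolding eq by (rule *(2))
qed

lemma pure_hom_left:
  assumes "y \<in> carrier A" shows "(\<lambda>x. AA.pure x y) \<in> hom (add_monoid A) AA.T"
  using AA.pure_closed[of _ y] AA.pure_add_left[of _ _ y] assms
  by (auto simp: hom_def )

lemma pure_hom_right:
  assumes "x \<in> carrier A" shows "(\<lambda>y. AA.pure x y) \<in> hom (add_monoid A) AA.T"
  using AA.pure_closed[of x] AA.pure_add_right[of x] assms
  by (auto simp: hom_def )

text \<open>
  For \<open>m = 1\<close> and \<open>\<sigma> = id\<close> this is the multiplication map; for general \<open>m\<close> it is the map
  \<open>x \<otimes> y \<mapsto> x m y\<close> through which a separability element acts as an averaging operator.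
\<close>

lemma lift_ring_mult:
  assumes S: "ring S" and \<sigma>: "\<sigma> \<in> Ring.ring_hom A S" and m: "m \<in> carrier S"
    and comm: "\<And>b. b \<in> carrier B \<Longrightarrow> m \<otimes>\<^bsub>S\<^esub> \<sigma> (\<phi> b) = \<sigma> (\<phi> b) \<otimes>\<^bsub>S\<^esub> m"
  obtains h where "h \<in> hom AA.T (add_monoid S)"
    "\<And>x y. \<lbrakk>x \<in> carrier A; y \<in> carrier A\<rbrakk> \<Longrightarrow> h (AA.pure x y) = \<sigma> x \<otimes>\<^bsub>S\<^esub> m \<otimes>\<^bsub>S\<^esub> \<sigma> y"
proof -
  interpret S: ring S by (rule S)
  note [simp] = ring_hom_closed[OF \<sigma>]
  show ?thesis
  proof (rule AA.lift[OF S.a_comm_group, of "\<lambda>x y. \<sigma> x \<otimes>\<^bsub>S\<^esub> m \<otimes>\<^bsub>S\<^esub> \<sigma> y"])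
    fix x b y
    assume "x \<in> carrier (ring_bimod A id \<phi>)" "b \<in> carrier B" "y \<in> carrier (ring_bimod A \<phi> id)"
    then have *: "x \<in> carrier A" "b \<in> carrier B" "y \<in> carrier A" by auto
    then have "\<sigma> (x \<otimes>\<^bsub>A\<^esub> \<phi> b) \<otimes>\<^bsub>S\<^esub> m \<otimes>\<^bsub>S\<^esub> \<sigma> y = \<sigma> x \<otimes>\<^bsub>S\<^esub> (\<sigma> (\<phi> b) \<otimes>\<^bsub>S\<^esub> m) \<otimes>\<^bsub>S\<^esub> \<sigma> y"
      using m by (simp add: ring_hom_mult[OF \<sigma>] S.m_assoc)
    also have "\<dots> = \<sigma> x \<otimes>\<^bsub>S\<^esub> m \<otimes>\<^bsub>S\<^esub> \<sigma> (\<phi> b \<otimes>\<^bsub>A\<^esub> y)"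
      using m * by (simp add: ring_hom_mult[OF \<sigma>] S.m_assoc flip: comm)
    finally show "\<sigma> (ract (ring_bimod A id \<phi>) x b) \<otimes>\<^bsub>S\<^esub> m \<otimes>\<^bsub>S\<^esub> \<sigma> y
        = \<sigma> x \<otimes>\<^bsub>S\<^esub> m \<otimes>\<^bsub>S\<^esub> \<sigma> (lact (ring_bimod A \<phi> id) b y)"
      by simp
  qed (use m in \<open>auto simp: ring_hom_add[OF \<sigma>] S.l_distr S.r_distr intro: that\<close>)
qed

lemma mult_map_exists: "\<exists>\<mu>. is_mult_map A B \<phi> \<mu>"
proof -
  have id: "(\<lambda>x. x) \<in> Ring.ring_hom A A" by (simp add: Ring.ring_hom_def)
  obtain h where "h \<in> hom AA.T (add_monoid A)"
    "\<And>x y. \<lbrakk>x \<in> carrier A; y \<in> carrier A\<rbrakk> \<Longrightarrow> h (AA.pure x y) = x \<otimes>\<^bsub>A\<^esub> \<one>\<^bsub>A\<^esub> \<otimes>\<^bsub>A\<^esub> y"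
    by (rule lift_ring_mult[OF A.ring_axioms id A.one_closed]) auto
  then show ?thesis by (auto simp: is_mult_map_def self_tensor_eq)
qed

text \<open>
  By associativity of the multiplication, since both sides of each equation are additive and agree on pure
  tensors.
\<close>

lemma mult_map_bimod_hom:
  assumes \<mu>: "is_mult_map A B \<phi> \<mu>"
  shows "\<mu> \<in> bimod_hom A A (self_tensor A B \<phi>) (ring_bimod A id id)"
proof -
  have hom: "\<mu> \<in> hom AA.T (add_monoid A)"
    and pure: "\<And>x y. \<lbrakk>x \<in> carrier A; y \<in> carrier A\<rbrakk> \<Longrightarrow> \<mu> (AA.pure x y) = x \<otimes>\<^bsub>A\<^esub> y"
    using \<mu> by (auto simp: is_mult_map_def self_tensor_eq)
  have "\<mu> (ract AA.T X t) = \<mu> X \<otimes>\<^bsub>A\<^esub> t" if t: "t \<in> carrier A" and X: "X \<in> carrier AA.T" for X t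
  proof (rule AA.hom_eqI[OF _ _ A.a_group _ X])
    show "(\<lambda>X. \<mu> (ract AA.T X t)) \<in> hom AA.T (add_monoid A)"
      using hom_compose[OF ract_hom(1)[OF t] hom] by (simp add: comp_def)
    show "(\<lambda>X. \<mu> X \<otimes>\<^bsub>A\<^esub> t) \<in> hom AA.T (add_monoid A)"
      using hom t by (auto simp: hom_def A.l_distr Pi_iff)
    fix x y assume "x \<in> carrier (ring_bimod A id \<phi>)" "y \<in> carrier (ring_bimod A \<phi> id)"
    then show "\<mu> (ract AA.T (AA.pure x y) t) = \<mu> (AA.pure x y) \<otimes>\<^bsub>A\<^esub> t"
      unfolding ract_hom(2)[OF t] using t by (simp add: pure A.m_assoc)
  qed
  moreover have "\<mu> (lact AA.T s X) = s \<otimes>\<^bsub>A\<^esub> \<mu> X" if s: "s \<in> carrier A" and X: "X \<in> carrier AA.T" for X s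
  proof (rule AA.hom_eqI[OF _ _ A.a_group _ X])
    show "(\<lambda>X. \<mu> (lact AA.T s X)) \<in> hom AA.T (add_monoid A)"
      using hom_compose[OF lact_hom(1)[OF s] hom] by (simp add: comp_def)
    show "(\<lambda>X. s \<otimes>\<^bsub>A\<^esub> \<mu> X) \<in> hom AA.T (add_monoid A)"
      using hom s by (auto simp: hom_def A.r_distr Pi_iff)
    fix x y assume "x \<in> carrier (ring_bimod A id \<phi>)" "y \<in> carrier (ring_bimod A \<phi> id)"
    then show "\<mu> (lact AA.T s (AA.pure x y)) = s \<otimes>\<^bsub>A\<^esub> \<mu> (AA.pure x y)"
      unfolding lact_hom(2)[OF s] using s by (simp add: pure A.m_assoc)
  qed
  moreover have "\<mu> \<in> hom AA.T (ring_bimod A id id)" using hom by (simp add: hom_def )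
  ultimately show ?thesis
    by (simp add: bimod_hom_def rmod_hom_def self_tensor_eq)
qed

text \<open>
  The hypotheses say that \<open>e = \<Sum>\<^sub>j x\<^sub>j \<otimes> y\<^sub>j\<close> is a separability element: the multiplication map sends it to \<open>1\<close>,
  and \<open>t e = e t\<close> because both sides expand to \<open>\<Sum>\<^sub>j \<Sum>\<^sub>l x\<^sub>j \<alpha>\<^sub>j\<^sub>l \<otimes> y\<^sub>l\<close>: left and right multiplication by \<open>t\<close> have the
  same matrix \<open>\<alpha>\<close> on the two families, and its entries move across the tensor sign. The section of the
  multiplication map is \<open>a \<mapsto> a e\<close>.
\<close>

lemma separable_extensionI:
  assumes fin: "finite J" and x: "\<And>j. j \<in> J \<Longrightarrow> x j \<in> carrier A" and y: "\<And>j. j \<in> J \<Longrightarrow> y j \<in> carrier A"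
    and unit: "(\<Oplus>\<^bsub>A\<^esub>j\<in>J. x j \<otimes>\<^bsub>A\<^esub> y j) = \<one>\<^bsub>A\<^esub>"
    and casimir: "\<And>t. t \<in> carrier A \<Longrightarrow> \<exists>\<alpha>. (\<forall>j\<in>J. \<forall>l\<in>J. \<alpha> j l \<in> carrier B) \<and>
      (\<forall>l\<in>J. t \<otimes>\<^bsub>A\<^esub> x l = (\<Oplus>\<^bsub>A\<^esub>j\<in>J. x j \<otimes>\<^bsub>A\<^esub> \<phi> (\<alpha> j l))) \<and>
      (\<forall>j\<in>J. y j \<otimes>\<^bsub>A\<^esub> t = (\<Oplus>\<^bsub>A\<^esub>l\<in>J. \<phi> (\<alpha> j l) \<otimes>\<^bsub>A\<^esub> y l))"
  shows "separable_extension A B \<phi>"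
proof -
  obtain \<mu> where \<mu>: "is_mult_map A B \<phi> \<mu>" using mult_map_exists by blast
  have hom: "\<mu> \<in> hom AA.T (add_monoid A)"
    and \<mu>_pure: "\<And>x y. \<lbrakk>x \<in> carrier A; y \<in> carrier A\<rbrakk> \<Longrightarrow> \<mu> (AA.pure x y) = x \<otimes>\<^bsub>A\<^esub> y"
    using \<mu> by (auto simp: is_mult_map_def self_tensor_eq)
  have pure_closed: "AA.pure a b \<in> carrier AA.T" if "a \<in> carrier A" "b \<in> carrier A" for a b
    using AA.pure_closed that by simp
  define g where "g a = finprod AA.T (\<lambda>j. AA.pure (a \<otimes>\<^bsub>A\<^esub> x j) (y j)) J" for a
  have g_closed: "g a \<in> carrier AA.T" if "a \<in> carrier A" for a
    unfolding g_def using that x y by (intro AA.T.finprod_closed) (auto intro: pure_closed)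
  have g_add: "g (a \<oplus>\<^bsub>A\<^esub> b) = g a \<otimes>\<^bsub>AA.T\<^esub> g b" if "a \<in> carrier A" "b \<in> carrier A" for a b
  proof -
    have "g (a \<oplus>\<^bsub>A\<^esub> b) = finprod AA.T (\<lambda>j. AA.pure (a \<otimes>\<^bsub>A\<^esub> x j) (y j) \<otimes>\<^bsub>AA.T\<^esub> AA.pure (b \<otimes>\<^bsub>A\<^esub> x j) (y j)) J"
      unfolding g_def
      by (rule AA.T.finprod_cong')
        (use that x y hom_mult[OF pure_hom_left] in \<open>auto simp: A.l_distr intro!: pure_closed\<close>)
    also have "\<dots> = g a \<otimes>\<^bsub>AA.T\<^esub> g b"
      unfolding g_def using that x y by (intro AA.T.finprod_multf) (auto intro: pure_closed)
    finally show ?thesis .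
  qed
  have g_lact: "lact AA.T s (g a) = g (s \<otimes>\<^bsub>A\<^esub> a)" if "s \<in> carrier A" "a \<in> carrier A" for s a
  proof -
    have "lact AA.T s (g a) = finprod AA.T (\<lambda>j. lact AA.T s (AA.pure (a \<otimes>\<^bsub>A\<^esub> x j) (y j))) J"
      unfolding g_def using that x y
      by (intro finprod_hom AA.T.comm_group_axioms lact_hom) (auto intro: pure_closed)
    also have "\<dots> = g (s \<otimes>\<^bsub>A\<^esub> a)"
      unfolding g_def
      by (rule AA.T.finprod_cong') (use that x y in \<open>auto simp: lact_hom(2) A.m_assoc intro!: pure_closed\<close>)
    finally show ?thesis .
  qed
  have g_ract: "ract AA.T (g a) t = g (a \<otimes>\<^bsub>A\<^esub> t)" if a: "a \<in> carrier A" and t: "t \<in> carrier A" for a t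
  proof -
    obtain \<alpha> where \<alpha>: "\<And>j l. j \<in> J \<Longrightarrow> l \<in> J \<Longrightarrow> \<alpha> j l \<in> carrier B"
      and left: "\<And>l. l \<in> J \<Longrightarrow> t \<otimes>\<^bsub>A\<^esub> x l = (\<Oplus>\<^bsub>A\<^esub>j\<in>J. x j \<otimes>\<^bsub>A\<^esub> \<phi> (\<alpha> j l))"
      and right: "\<And>j. j \<in> J \<Longrightarrow> y j \<otimes>\<^bsub>A\<^esub> t = (\<Oplus>\<^bsub>A\<^esub>l\<in>J. \<phi> (\<alpha> j l) \<otimes>\<^bsub>A\<^esub> y l)"
      using casimir[OF t] by blast
    let ?p = "\<lambda>j l. AA.pure (a \<otimes>\<^bsub>A\<^esub> x j \<otimes>\<^bsub>A\<^esub> \<phi> (\<alpha> j l)) (y l)"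
    have p: "?p j l \<in> carrier AA.T" if "j \<in> J" "l \<in> J" for j l
      using that a x y \<alpha> by (intro pure_closed) auto
    have "ract AA.T (g a) t = finprod AA.T (\<lambda>j. ract AA.T (AA.pure (a \<otimes>\<^bsub>A\<^esub> x j) (y j)) t) J"
      unfolding g_def using a t x y
      by (intro finprod_hom[where f = "\<lambda>X. ract AA.T X t"] AA.T.comm_group_axioms ract_hom) (auto intro: pure_closed)
    also have "\<dots> = finprod AA.T (\<lambda>j. finprod AA.T (?p j) J) J"
    proof (rule AA.T.finprod_cong'[OF refl])
      fix j assume j: "j \<in> J"
      have "ract AA.T (AA.pure (a \<otimes>\<^bsub>A\<^esub> x j) (y j)) t
          = AA.pure (a \<otimes>\<^bsub>A\<^esub> x j) (\<Oplus>\<^bsub>A\<^esub>l\<in>J. \<phi> (\<alpha> j l) \<otimes>\<^bsub>A\<^esub> y l)"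
        using ract_hom(2)[OF t] right[OF j] by simp
      also have "\<dots> = finprod AA.T (\<lambda>l. AA.pure (a \<otimes>\<^bsub>A\<^esub> x j) (\<phi> (\<alpha> j l) \<otimes>\<^bsub>A\<^esub> y l)) J"
        unfolding finsum_def using a x y j \<alpha>
        by (intro finprod_hom A.a_comm_group AA.T.comm_group_axioms pure_hom_right) auto
      also have "\<dots> = finprod AA.T (?p j) J"
        by (rule AA.T.finprod_cong')
          (use p j a x y \<alpha> AA.pure_balanced[of "a \<otimes>\<^bsub>A\<^esub> x j"] in \<open>auto\<close>)
      finally show "ract AA.T (AA.pure (a \<otimes>\<^bsub>A\<^esub> x j) (y j)) t = finprod AA.T (?p j) J" .
    qed (use p in \<open>auto intro!: AA.T.finprod_closed\<close>)
    also have "\<dots> = finprod AA.T (\<lambda>l. finprod AA.T (\<lambda>j. ?p j l) J) J"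
      by (rule AA.T.finprod_swap[OF fin fin p])
    also have "\<dots> = g (a \<otimes>\<^bsub>A\<^esub> t)"
      unfolding g_def
    proof (rule AA.T.finprod_cong'[OF refl])
      fix l assume l: "l \<in> J"
      have "finprod AA.T (\<lambda>j. ?p j l) J = AA.pure (\<Oplus>\<^bsub>A\<^esub>j\<in>J. a \<otimes>\<^bsub>A\<^esub> x j \<otimes>\<^bsub>A\<^esub> \<phi> (\<alpha> j l)) (y l)"
        unfolding finsum_def using a x y l \<alpha>
        by (intro finprod_hom[symmetric, where f = "\<lambda>z. AA.pure z (y l)"] A.a_comm_group AA.T.comm_group_axioms pure_hom_left) auto
      also have "(\<Oplus>\<^bsub>A\<^esub>j\<in>J. a \<otimes>\<^bsub>A\<^esub> x j \<otimes>\<^bsub>A\<^esub> \<phi> (\<alpha> j l)) = (\<Oplus>\<^bsub>A\<^esub>j\<in>J. a \<otimes>\<^bsub>A\<^esub> (x j \<otimes>\<^bsub>A\<^esub> \<phi> (\<alpha> j l)))"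
        by (rule A.finsum_cong') (use a x l \<alpha> in \<open>auto simp: A.m_assoc\<close>)
      also have "\<dots> = a \<otimes>\<^bsub>A\<^esub> (\<Oplus>\<^bsub>A\<^esub>j\<in>J. x j \<otimes>\<^bsub>A\<^esub> \<phi> (\<alpha> j l))"
        by (rule A.finsum_rdistr[symmetric, OF fin a]) (use x l \<alpha> in auto)
      also have "\<dots> = a \<otimes>\<^bsub>A\<^esub> t \<otimes>\<^bsub>A\<^esub> x l"
        using a t x l by (simp add: left[symmetric] A.m_assoc)
      finally show "finprod AA.T (\<lambda>j. ?p j l) J = AA.pure (a \<otimes>\<^bsub>A\<^esub> t \<otimes>\<^bsub>A\<^esub> x l) (y l)" .
    qed (use a t x y in \<open>auto intro!: pure_closed\<close>)
    finally show ?thesis .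
  qed
  have "g \<in> bimod_hom A A (ring_bimod A id id) AA.T"
    by (simp add: bimod_hom_def rmod_hom_def hom_def g_closed g_add g_lact g_ract)
  moreover have "\<mu> (g a) = a" if a: "a \<in> carrier A" for a
  proof -
    have "\<mu> (g a) = (\<Oplus>\<^bsub>A\<^esub>j\<in>J. \<mu> (AA.pure (a \<otimes>\<^bsub>A\<^esub> x j) (y j)))"
      unfolding g_def finsum_def using a x y
      by (intro finprod_hom AA.T.comm_group_axioms A.a_comm_group hom) (auto intro: pure_closed)
    also have "\<dots> = (\<Oplus>\<^bsub>A\<^esub>j\<in>J. a \<otimes>\<^bsub>A\<^esub> (x j \<otimes>\<^bsub>A\<^esub> y j))"
      by (rule A.finsum_cong') (use a x y in \<open>auto simp: \<mu>_pure A.m_assoc\<close>)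
    also have "\<dots> = a"
      using A.finsum_rdistr[OF fin a, of "\<lambda>j. x j \<otimes>\<^bsub>A\<^esub> y j"] a x y unit by simp
    finally show ?thesis .
  qed
  ultimately have "split_epi A A (self_tensor A B \<phi>) (ring_bimod A id id) \<mu>"
    unfolding split_epi_def using mult_map_bimod_hom[OF \<mu>]
    by (auto simp: self_tensor_eq )
  then show ?thesis unfolding separable_extension_def using is_ring_extension \<mu> by blast
qed

end

section \<open>Averaging over a separable extension\<close>

definition commutant :: "('a, 'x) ring_scheme \<Rightarrow> 'a set \<Rightarrow> 'a set"
  where "commutant S X = {m \<in> carrier S. \<forall>x\<in>X. x \<otimes>\<^bsub>S\<^esub> m = m \<otimes>\<^bsub>S\<^esub> x}"

text \<open>
  If \<open>\<Sum>\<^sub>i x\<^sub>i \<otimes> y\<^sub>i\<close> is a separability element, then \<open>E m = \<Sum>\<^sub>i x\<^sub>i m y\<^sub>i\<close> turns elements commuting with \<open>B\<close> into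
  elements commuting with \<open>A\<close>, it is linear over the commutant of \<open>A\<close>, and it fixes \<open>1\<close>. Here the
  separability element is the value \<open>X\<close> at \<open>1\<close> of a section of the multiplication map, and \<open>h m\<close> is the
  map \<open>x \<otimes> y \<mapsto> x m y\<close>, so that no representation of \<open>X\<close> as a sum has to be chosen.
\<close>

lemma (in extension) separable_averaging:
  assumes sep: "separable_extension A B \<phi>" and S: "ring S" and \<sigma>: "\<sigma> \<in> Ring.ring_hom A S"
  obtains E where
    "\<And>m. m \<in> commutant S (\<sigma> ` \<phi> ` carrier B) \<Longrightarrow> E m \<in> commutant S (\<sigma> ` carrier A)"
    "\<And>p m q. \<lbrakk>p \<in> commutant S (\<sigma> ` carrier A); m \<in> commutant S (\<sigma> ` \<phi> ` carrier B);
        q \<in> commutant S (\<sigma> ` carrier A)\<rbrakk> \<Longrightarrow> E (p \<otimes>\<^bsub>S\<^esub> m \<otimes>\<^bsub>S\<^esub> q) = p \<otimes>\<^bsub>S\<^esub> E m \<otimes>\<^bsub>S\<^esub> q"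
    "E \<one>\<^bsub>S\<^esub> = \<one>\<^bsub>S\<^esub>"
proof -
  interpret S: ring S by (rule S)
  note \<sigma>_closed [simp] = ring_hom_closed[OF \<sigma>]
  let ?CA = "commutant S (\<sigma> ` carrier A)" and ?CB = "commutant S (\<sigma> ` \<phi> ` carrier B)"
  obtain \<mu> g where \<mu>: "is_mult_map A B \<phi> \<mu>"
    and g: "g \<in> bimod_hom A A (ring_bimod A id id) AA.T"
    and \<mu>g: "\<And>a. a \<in> carrier A \<Longrightarrow> \<mu> (g a) = a"
    using sep by (auto simp: separable_extension_def split_epi_def self_tensor_eq)
  define X where "X = g \<one>\<^bsub>A\<^esub>"
  have X: "X \<in> carrier AA.T"
    using g hom_in_carrier[of g "ring_bimod A id id" AA.T "\<one>\<^bsub>A\<^esub>"]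
    by (simp add: X_def bimod_hom_def rmod_hom_def)
  have lact_X: "lact AA.T a X = g a" and ract_X: "ract AA.T X a = g a" if "a \<in> carrier A" for a
  proof -
    have "g (lact (ring_bimod A id id) a \<one>\<^bsub>A\<^esub>) = lact AA.T a X"
      "g (ract (ring_bimod A id id) \<one>\<^bsub>A\<^esub> a) = ract AA.T X a"
      using g that unfolding X_def bimod_hom_def rmod_hom_def by fastforce+
    then show "lact AA.T a X = g a" "ract AA.T X a = g a" using that by auto
  qed
  have "\<forall>m\<in>?CB. \<exists>h. h \<in> hom AA.T (add_monoid S) \<and>
      (\<forall>x\<in>carrier A. \<forall>y\<in>carrier A. h (AA.pure x y) = \<sigma> x \<otimes>\<^bsub>S\<^esub> m \<otimes>\<^bsub>S\<^esub> \<sigma> y)"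
  proof
    fix m assume m: "m \<in> ?CB"
    obtain h where "h \<in> hom AA.T (add_monoid S)"
      "\<And>x y. \<lbrakk>x \<in> carrier A; y \<in> carrier A\<rbrakk> \<Longrightarrow> h (AA.pure x y) = \<sigma> x \<otimes>\<^bsub>S\<^esub> m \<otimes>\<^bsub>S\<^esub> \<sigma> y"
      using lift_ring_mult[OF S \<sigma>, of m] m by (auto simp: commutant_def)
    then show "\<exists>h. h \<in> hom AA.T (add_monoid S) \<and>
      (\<forall>x\<in>carrier A. \<forall>y\<in>carrier A. h (AA.pure x y) = \<sigma> x \<otimes>\<^bsub>S\<^esub> m \<otimes>\<^bsub>S\<^esub> \<sigma> y)" by blast
  qed
  then obtain h where h_hom: "\<And>m. m \<in> ?CB \<Longrightarrow> h m \<in> hom AA.T (add_monoid S)"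
    and h_pure: "\<And>m x y. \<lbrakk>m \<in> ?CB; x \<in> carrier A; y \<in> carrier A\<rbrakk>
      \<Longrightarrow> h m (AA.pure x y) = \<sigma> x \<otimes>\<^bsub>S\<^esub> m \<otimes>\<^bsub>S\<^esub> \<sigma> y"
    by metis
  have h_closed: "h m Y \<in> carrier S" if "m \<in> ?CB" "Y \<in> carrier AA.T" for m Y
    using hom_in_carrier[OF h_hom] that by simp
  have mult_left: "(\<lambda>Y. p \<otimes>\<^bsub>S\<^esub> f Y) \<in> hom AA.T (add_monoid S)"
    and mult_right: "(\<lambda>Y. f Y \<otimes>\<^bsub>S\<^esub> p) \<in> hom AA.T (add_monoid S)"
    if "f \<in> hom AA.T (add_monoid S)" "p \<in> carrier S" for f p
    using that by (auto simp: hom_def S.r_distr S.l_distr Pi_iff)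
  have CA_CB: "p \<in> ?CB" if "p \<in> ?CA" for p using that by (auto simp: commutant_def)
  show ?thesis
  proof (rule that[of "\<lambda>m. h m X"])
    fix m assume m: "m \<in> ?CB"
    then have mS: "m \<in> carrier S" by (simp add: commutant_def)
    have "\<sigma> a \<otimes>\<^bsub>S\<^esub> h m X = h m X \<otimes>\<^bsub>S\<^esub> \<sigma> a" if a: "a \<in> carrier A" for a
    proof -
      have "\<sigma> a \<otimes>\<^bsub>S\<^esub> h m X = h m (lact AA.T a X)"
      proof (rule AA.hom_eqI[OF _ _ S.a_group _ X])
        show "(\<lambda>Y. h m (lact AA.T a Y)) \<in> hom AA.T (add_monoid S)"
          using hom_compose[OF lact_hom(1)[OF a] h_hom[OF m]] by (simp add: comp_def)
        fix x y assume "x \<in> carrier (ring_bimod A id \<phi>)" "y \<in> carrier (ring_bimod A \<phi> id)"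
        then show "\<sigma> a \<otimes>\<^bsub>S\<^esub> h m (AA.pure x y) = h m (lact AA.T a (AA.pure x y))"
          unfolding lact_hom(2)[OF a] using a mS
          by (simp add: h_pure[OF m] ring_hom_mult[OF \<sigma>] S.m_assoc)
      qed (use mult_left h_hom m a in auto)
      also have "\<dots> = h m (ract AA.T X a)" using lact_X ract_X a by simp
      also have "\<dots> = h m X \<otimes>\<^bsub>S\<^esub> \<sigma> a"
      proof (rule AA.hom_eqI[OF _ _ S.a_group _ X])
        show "(\<lambda>Y. h m (ract AA.T Y a)) \<in> hom AA.T (add_monoid S)"
          using hom_compose[OF ract_hom(1)[OF a] h_hom[OF m]] by (simp add: comp_def)
        fix x y assume "x \<in> carrier (ring_bimod A id \<phi>)" "y \<in> carrier (ring_bimod A \<phi> id)"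
        then show "h m (ract AA.T (AA.pure x y) a) = h m (AA.pure x y) \<otimes>\<^bsub>S\<^esub> \<sigma> a"
          unfolding ract_hom(2)[OF a] using a mS
          by (simp add: h_pure[OF m] ring_hom_mult[OF \<sigma>] S.m_assoc)
      qed (use mult_right h_hom m a in auto)
      finally show ?thesis .
    qed
    then show "h m X \<in> ?CA" using h_closed[OF m X] by (auto simp: commutant_def)
  next
    fix p m q assume p: "p \<in> ?CA" and m: "m \<in> ?CB" and q: "q \<in> ?CA"
    then have carr: "p \<in> carrier S" "m \<in> carrier S" "q \<in> carrier S" by (auto simp: commutant_def)
    have comm: "\<sigma> a \<otimes>\<^bsub>S\<^esub> p = p \<otimes>\<^bsub>S\<^esub> \<sigma> a" "\<sigma> a \<otimes>\<^bsub>S\<^esub> q = q \<otimes>\<^bsub>S\<^esub> \<sigma> a" if "a \<in> carrier A" for a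
      using p q that by (auto simp: commutant_def)
    have "\<sigma> (\<phi> b) \<otimes>\<^bsub>S\<^esub> (p \<otimes>\<^bsub>S\<^esub> m \<otimes>\<^bsub>S\<^esub> q) = p \<otimes>\<^bsub>S\<^esub> m \<otimes>\<^bsub>S\<^esub> q \<otimes>\<^bsub>S\<^esub> \<sigma> (\<phi> b)" if b: "b \<in> carrier B" for b
    proof -
      have mb: "\<sigma> (\<phi> b) \<otimes>\<^bsub>S\<^esub> m = m \<otimes>\<^bsub>S\<^esub> \<sigma> (\<phi> b)" using m b by (auto simp: commutant_def)
      have "\<sigma> (\<phi> b) \<otimes>\<^bsub>S\<^esub> (p \<otimes>\<^bsub>S\<^esub> m \<otimes>\<^bsub>S\<^esub> q) = p \<otimes>\<^bsub>S\<^esub> (\<sigma> (\<phi> b) \<otimes>\<^bsub>S\<^esub> m) \<otimes>\<^bsub>S\<^esub> q"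
        using carr b comm(1)[of "\<phi> b"] by (simp flip: S.m_assoc)
      also have "\<dots> = p \<otimes>\<^bsub>S\<^esub> m \<otimes>\<^bsub>S\<^esub> (\<sigma> (\<phi> b) \<otimes>\<^bsub>S\<^esub> q)"
        using carr b by (simp add: mb S.m_assoc)
      finally show ?thesis using carr b comm(2)[of "\<phi> b"] by (simp add: S.m_assoc)
    qed
    then have pmq: "p \<otimes>\<^bsub>S\<^esub> m \<otimes>\<^bsub>S\<^esub> q \<in> ?CB" using carr by (auto simp: commutant_def)
    show "h (p \<otimes>\<^bsub>S\<^esub> m \<otimes>\<^bsub>S\<^esub> q) X = p \<otimes>\<^bsub>S\<^esub> h m X \<otimes>\<^bsub>S\<^esub> q"
    proof (rule AA.hom_eqI[OF _ _ S.a_group _ X])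
      fix x y assume "x \<in> carrier (ring_bimod A id \<phi>)" "y \<in> carrier (ring_bimod A \<phi> id)"
      then have xy: "x \<in> carrier A" "y \<in> carrier A" by simp_all
      have "h (p \<otimes>\<^bsub>S\<^esub> m \<otimes>\<^bsub>S\<^esub> q) (AA.pure x y) = (\<sigma> x \<otimes>\<^bsub>S\<^esub> p) \<otimes>\<^bsub>S\<^esub> m \<otimes>\<^bsub>S\<^esub> (q \<otimes>\<^bsub>S\<^esub> \<sigma> y)"
        unfolding h_pure[OF pmq xy] using xy carr by (simp add: S.m_assoc)
      also have "\<dots> = p \<otimes>\<^bsub>S\<^esub> (\<sigma> x \<otimes>\<^bsub>S\<^esub> m \<otimes>\<^bsub>S\<^esub> \<sigma> y) \<otimes>\<^bsub>S\<^esub> q"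
        using xy carr by (simp add: comm(1) comm(2)[symmetric] S.m_assoc)
      finally show "h (p \<otimes>\<^bsub>S\<^esub> m \<otimes>\<^bsub>S\<^esub> q) (AA.pure x y) = p \<otimes>\<^bsub>S\<^esub> h m (AA.pure x y) \<otimes>\<^bsub>S\<^esub> q"
        using h_pure[OF m] xy by simp
    qed (use mult_left mult_right h_hom m pmq carr in auto)
  next
    have one: "\<one>\<^bsub>S\<^esub> \<in> ?CB" by (auto simp: commutant_def)
    have "h \<one>\<^bsub>S\<^esub> X = \<sigma> (\<mu> X)"
    proof (rule AA.hom_eqI[OF _ _ S.a_group _ X])
      show "(\<lambda>Y. \<sigma> (\<mu> Y)) \<in> hom AA.T (add_monoid S)"
        using \<mu> by (auto simp: is_mult_map_def self_tensor_eq hom_def Pi_iff ring_hom_add[OF \<sigma>])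
      fix x y assume "x \<in> carrier (ring_bimod A id \<phi>)" "y \<in> carrier (ring_bimod A \<phi> id)"
      then show "h \<one>\<^bsub>S\<^esub> (AA.pure x y) = \<sigma> (\<mu> (AA.pure x y))"
        using \<mu> by (simp add: h_pure[OF one] is_mult_map_def ring_hom_mult[OF \<sigma>])
    qed (use h_hom one in auto)
    then show "h \<one>\<^bsub>S\<^esub> X = \<one>\<^bsub>S\<^esub>" using \<mu>g ring_hom_one[OF \<sigma>] by (simp add: X_def)
  qed
qed

text \<open>
  An inner inverse \<open>m\<close> of \<open>x\<close> averages to one that commutes with \<open>A\<close>: apply \<open>E\<close> to \<open>x = x m x\<close>.
\<close>

lemma (in extension) commutant_regular_if_separable:
  assumes sep: "separable_extension A B \<phi>" and S: "ring S" and \<sigma>: "\<sigma> \<in> Ring.ring_hom A S"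
    and x: "x \<in> commutant S (\<sigma> ` carrier A)" and m: "m \<in> commutant S (\<sigma> ` \<phi> ` carrier B)"
    and reg: "x \<otimes>\<^bsub>S\<^esub> m \<otimes>\<^bsub>S\<^esub> x = x"
  shows "\<exists>k\<in>commutant S (\<sigma> ` carrier A). x \<otimes>\<^bsub>S\<^esub> k \<otimes>\<^bsub>S\<^esub> x = x"
proof -
  interpret S: ring S by (rule S)
  note [simp] = ring_hom_closed[OF \<sigma>]
  obtain E where E: "\<And>m. m \<in> commutant S (\<sigma> ` \<phi> ` carrier B) \<Longrightarrow> E m \<in> commutant S (\<sigma> ` carrier A)"
    and bimod: "\<And>p m q. \<lbrakk>p \<in> commutant S (\<sigma> ` carrier A); m \<in> commutant S (\<sigma> ` \<phi> ` carrier B);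
        q \<in> commutant S (\<sigma> ` carrier A)\<rbrakk> \<Longrightarrow> E (p \<otimes>\<^bsub>S\<^esub> m \<otimes>\<^bsub>S\<^esub> q) = p \<otimes>\<^bsub>S\<^esub> E m \<otimes>\<^bsub>S\<^esub> q"
    and one: "E \<one>\<^bsub>S\<^esub> = \<one>\<^bsub>S\<^esub>"
    by (rule separable_averaging[OF sep S \<sigma>]) (rule that)
  have xS: "x \<in> carrier S" using x by (simp add: commutant_def)
  have ones: "\<one>\<^bsub>S\<^esub> \<in> commutant S (\<sigma> ` carrier A)" "\<one>\<^bsub>S\<^esub> \<in> commutant S (\<sigma> ` \<phi> ` carrier B)"
    by (auto simp: commutant_def)
  have "E x = x" using bimod[OF x ones(2,1)] one xS by simp
  then have "x \<otimes>\<^bsub>S\<^esub> E m \<otimes>\<^bsub>S\<^esub> x = x" using bimod[OF x m x] reg by simp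
  then show ?thesis using E[OF m] by blast
qed

section \<open>Regularity and diagonalizability of matrices\<close>

text \<open>
  McCoy's lemma: since \<open>x - x g x = x (1 - g x) = (1 - x g) x\<close>, the element \<open>(1 - g x) m (1 - x g) + g\<close> is an
  inner inverse of \<open>x\<close> whenever \<open>m\<close> is one of \<open>x - x g x\<close>.
\<close>

lemma (in ring) regular_if_reduction_regular:
  assumes x: "x \<in> carrier R" and g: "g \<in> carrier R" and m: "m \<in> carrier R"
    and reg: "(x \<ominus> x \<otimes> g \<otimes> x) \<otimes> m \<otimes> (x \<ominus> x \<otimes> g \<otimes> x) = x \<ominus> x \<otimes> g \<otimes> x"
  shows "\<exists>k\<in>carrier R. x \<otimes> k \<otimes> x = x"
proof
  let ?p = "\<one> \<ominus> g \<otimes> x" and ?q = "\<one> \<ominus> x \<otimes> g"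
  let ?k = "?p \<otimes> m \<otimes> ?q \<oplus> g"
  have p: "x \<ominus> x \<otimes> g \<otimes> x = x \<otimes> ?p"
    using x g by (simp add: a_minus_def r_distr r_minus m_assoc)
  have q: "x \<ominus> x \<otimes> g \<otimes> x = ?q \<otimes> x"
    using x g by (simp add: a_minus_def l_distr l_minus m_assoc)
  have "x \<otimes> (?p \<otimes> m \<otimes> ?q) \<otimes> x = (x \<otimes> ?p) \<otimes> m \<otimes> (?q \<otimes> x)"
    using x g m by (simp add: m_assoc)
  also have "\<dots> = x \<ominus> x \<otimes> g \<otimes> x"
    using reg by (simp flip: p q)
  finally have *: "x \<otimes> (?p \<otimes> m \<otimes> ?q) \<otimes> x = x \<ominus> x \<otimes> g \<otimes> x" .
  have "x \<otimes> ?k \<otimes> x = x \<otimes> (?p \<otimes> m \<otimes> ?q) \<otimes> x \<oplus> x \<otimes> g \<otimes> x"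
    using x g m by (simp add: l_distr r_distr)
  also have "\<dots> = x"
    unfolding * using x g by (simp add: a_minus_def a_assoc l_neg)
  finally show "x \<otimes> ?k \<otimes> x = x" .
  show "?k \<in> carrier R" using x g m by simp
qed

text \<open>
  Wedderburn's rank reduction: at a nonzero entry \<open>(i,j)\<close>, the matrix \<open>G\<close> with the single entry
  \<open>1 / N\<^sub>i\<^sub>j\<close> at \<open>(j,i)\<close> makes row \<open>i\<close> of \<open>N - N G N\<close> vanish, while zero rows stay zero. So McCoy's lemma applies by
  induction on the number of nonzero rows.
\<close>

lemma square_matrix_von_Neumann_regular:
  fixes N :: "'r::field mat"
  assumes "N \<in> carrier_mat n n"
  shows "\<exists>M\<in>carrier_mat n n. N * M * N = N"
  using assms
proof (induction "card {i\<in>{..<n}. \<exists>j<n. N $$ (i,j) \<noteq> 0}" arbitrary: N rule: less_induct)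
  case less
  note N = less.prems
  interpret ring "ring_mat TYPE('r) n ()" by (rule ring_mat)
  show ?case
  proof (cases "\<exists>i<n. \<exists>j<n. N $$ (i,j) \<noteq> 0")
    case False
    then have "N = 0\<^sub>m n n" using N by (intro eq_matI) auto
    then show ?thesis by (intro bexI[of _ "0\<^sub>m n n"]) auto
  next
    case True
    then obtain i j where ij: "i < n" "j < n" "N $$ (i,j) \<noteq> 0" by blast
    define G where "G = mat n n (\<lambda>(a,b). if a = j \<and> b = i then 1 / N $$ (i,j) else 0)"
    have G: "G \<in> carrier_mat n n" unfolding G_def by simp
    define H where "H = N * G"
    have H: "H \<in> carrier_mat n n" using N G by (simp add: H_def)
    have NG: "H $$ (k,b) = (if b = i then N $$ (k,j) / N $$ (i,j) else 0)"
      if "k < n" "b < n" for k b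
    proof -
      have "H $$ (k,b) = (\<Sum>a = 0..<n. N $$ (k,a) * (if a = j \<and> b = i then 1 / N $$ (i,j) else 0))"
        using that N by (simp add: H_def G_def scalar_prod_def)
      also have "\<dots> = (\<Sum>a = 0..<n. if a = j then (if b = i then N $$ (k,j) / N $$ (i,j) else 0) else 0)"
        by (rule sum.cong) auto
      finally show ?thesis using ij by simp
    qed
    have NGN: "(H * N) $$ (k,l) = N $$ (k,j) * N $$ (i,l) / N $$ (i,j)"
      if "k < n" "l < n" for k l
    proof -
      have "(H * N) $$ (k,l) = (\<Sum>a = 0..<n. H $$ (k,a) * N $$ (a,l))"
        using that N H by (simp add: scalar_prod_def)
      also have "\<dots> = (\<Sum>a = 0..<n. if a = i then N $$ (k,j) * N $$ (i,l) / N $$ (i,j) else 0)"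
        by (rule sum.cong) (use that NG in auto)
      finally show ?thesis using ij by simp
    qed
    let ?N = "N - N * G * N"
    have N': "?N \<in> carrier_mat n n" using N G by auto
    have entry: "?N $$ (k,l) = N $$ (k,l) - N $$ (k,j) * N $$ (i,l) / N $$ (i,j)"
      if "k < n" "l < n" for k l
      using that N H NGN by (auto simp flip: H_def)
    have "{k\<in>{..<n}. \<exists>l<n. ?N $$ (k,l) \<noteq> 0} \<subset> {k\<in>{..<n}. \<exists>l<n. N $$ (k,l) \<noteq> 0}"
    proof
      show "{k\<in>{..<n}. \<exists>l<n. ?N $$ (k,l) \<noteq> 0} \<subseteq> {k\<in>{..<n}. \<exists>l<n. N $$ (k,l) \<noteq> 0}"
      proof
        fix k assume "k \<in> {k\<in>{..<n}. \<exists>l<n. ?N $$ (k,l) \<noteq> 0}"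
        then obtain l where kl: "k < n" "l < n" "?N $$ (k,l) \<noteq> 0" by blast
        then have "N $$ (k,l) \<noteq> 0 \<or> N $$ (k,j) \<noteq> 0" using entry[OF kl(1,2)] by auto
        then show "k \<in> {k\<in>{..<n}. \<exists>l<n. N $$ (k,l) \<noteq> 0}" using kl ij by blast
      qed
      have "i \<notin> {k\<in>{..<n}. \<exists>l<n. ?N $$ (k,l) \<noteq> 0}" using entry ij by simp
      then show "{k\<in>{..<n}. \<exists>l<n. ?N $$ (k,l) \<noteq> 0} \<noteq> {k\<in>{..<n}. \<exists>l<n. N $$ (k,l) \<noteq> 0}"
        using ij by blast
    qed
    then have "card {k\<in>{..<n}. \<exists>l<n. ?N $$ (k,l) \<noteq> 0} < card {k\<in>{..<n}. \<exists>l<n. N $$ (k,l) \<noteq> 0}"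
      by (intro psubset_card_mono) auto
    then obtain M where M: "M \<in> carrier_mat n n" "?N * M * ?N = ?N"
      using less.hyps N' by blast
    have minus: "X - Y = X \<ominus>\<^bsub>ring_mat TYPE('r) n ()\<^esub> Y"
      if "X \<in> carrier_mat n n" "Y \<in> carrier_mat n n" for X Y :: "'r mat"
    proof -
      have "\<ominus>\<^bsub>ring_mat TYPE('r) n ()\<^esub> Y = - Y"
        by (rule minus_equality) (use that in \<open>auto simp: ring_mat_simps\<close>)
      then show ?thesis using that by (simp add: a_minus_def ring_mat_simps minus_add_uminus_mat)
    qed
    have "\<exists>K\<in>carrier (ring_mat TYPE('r) n ()). N \<otimes>\<^bsub>ring_mat TYPE('r) n ()\<^esub> K \<otimes>\<^bsub>ring_mat TYPE('r) n ()\<^esub> N = N"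
      by (rule regular_if_reduction_regular[of _ G M])
        (use N G M minus[of N "N * G * N"] in \<open>auto simp: ring_mat_simps\<close>)
    then show ?thesis by (simp add: ring_mat_simps)
  qed
qed

lemma exists_eigenvector:
  fixes C :: "'r::alg_closed_field mat"
  assumes C: "C \<in> carrier_mat m m" and "m > 0"
  shows "\<exists>u a. u \<in> carrier_vec m \<and> u \<noteq> 0\<^sub>v m \<and> C *\<^sub>v u = a \<cdot>\<^sub>v u"
proof -
  have "degree (char_poly C) > 0" using degree_monic_char_poly[OF C] \<open>m > 0\<close> by simp
  then obtain a where "poly (char_poly C) a = 0" using alg_closed_imp_poly_has_root by blast
  then have "eigenvalue C a" using eigenvalue_root_char_poly[OF C] by simp
  then show ?thesis using C unfolding eigenvalue_def eigenvector_def by auto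
qed

text \<open>
  The rows of \<open>M\<close> in \<open>J\<close> vanish outside \<open>J\<close>, so the row vectors supported on \<open>J\<close> form an invariant subspace, and
  a left eigenvector of the square block \<open>M\<^sub>J\<^sub>J\<close> extends by zero. The block is reindexed by \<open>h\<close>, and \<open>C\<close> is its
  transpose.
\<close>

lemma left_eigenvector_supported_on:
  fixes M :: "'r::alg_closed_field mat"
  assumes M: "M \<in> carrier_mat n n" and J: "J \<subseteq> {..<n}" "J \<noteq> {}"
    and block: "\<And>j i. j \<in> J \<Longrightarrow> i < n \<Longrightarrow> i \<notin> J \<Longrightarrow> M $$ (j,i) = 0"
  shows "\<exists>y a. y \<in> carrier_vec n \<and> y \<noteq> 0\<^sub>v n \<and> (\<forall>i<n. i \<notin> J \<longrightarrow> y $ i = 0) \<and>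
    transpose_mat M *\<^sub>v y = a \<cdot>\<^sub>v y"
proof -
  have finJ: "finite J" using J finite_subset by blast
  define m where "m = card J"
  obtain h where h: "bij_betw h {0..<m} J"
    using ex_bij_betw_nat_finite[OF finJ] m_def by blast
  have hJ: "h b \<in> J" if "b < m" for b
    using h that by (auto simp: bij_betw_def)
  have hn: "h b < n" if "b < m" for b
    using hJ[OF that] J by auto
  define C where "C = mat m m (\<lambda>(a,b). M $$ (h b, h a))"
  have C: "C \<in> carrier_mat m m" unfolding C_def by simp
  have "m > 0" using J finJ m_def by (simp add: card_gt_0_iff)
  then obtain u a where u: "u \<in> carrier_vec m" "u \<noteq> 0\<^sub>v m" and Cu: "C *\<^sub>v u = a \<cdot>\<^sub>v u"
    using exists_eigenvector[OF C] by blast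
  define y where "y = vec n (\<lambda>i. if i \<in> J then u $ the_inv_into {0..<m} h i else 0)"
  have yc: "y \<in> carrier_vec n" by (simp add: y_def)
  have yh: "y $ h b = u $ b" if "b < m" for b
    using h hJ[OF that] hn[OF that] that by (simp add: y_def bij_betw_def the_inv_into_f_f)
  have "(transpose_mat M *\<^sub>v y) $ i = (a \<cdot>\<^sub>v y) $ i" if i: "i < n" for i
  proof -
    have "(transpose_mat M *\<^sub>v y) $ i = (\<Sum>j = 0..<n. M $$ (j,i) * y $ j)"
      using M i by (simp add: scalar_prod_def y_def)
    also have "\<dots> = (\<Sum>j\<in>J. M $$ (j,i) * y $ j)"
      by (rule sum.mono_neutral_right) (use J in \<open>auto simp: y_def\<close>)
    also have "\<dots> = (\<Sum>b = 0..<m. M $$ (h b,i) * y $ h b)"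
      by (rule sum.reindex_bij_betw[OF h, symmetric])
    also have "\<dots> = (\<Sum>b = 0..<m. M $$ (h b,i) * u $ b)"
      by (rule sum.cong) (auto simp: yh)
    also have "\<dots> = (a \<cdot>\<^sub>v y) $ i"
    proof (cases "i \<in> J")
      case False
      then show ?thesis using block hJ i by (simp add: y_def)
    next
      case True
      then obtain b where b: "b < m" "i = h b" using h by (auto simp: bij_betw_def)
      have "(\<Sum>b' = 0..<m. M $$ (h b',i) * u $ b') = (C *\<^sub>v u) $ b"
        using b u by (simp add: C_def scalar_prod_def)
      also have "\<dots> = a * u $ b" using Cu b u by simp
      also have "\<dots> = (a \<cdot>\<^sub>v y) $ i" using b(2) i yh[OF b(1)] yc by simp
      finally show ?thesis .
    qed
    finally show ?thesis .
  qed
  then have "transpose_mat M *\<^sub>v y = a \<cdot>\<^sub>v y" using M by (intro eq_vecI) (auto simp: y_def)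
  moreover have "y \<noteq> 0\<^sub>v n"
  proof
    assume "y = 0\<^sub>v n"
    then have "u = 0\<^sub>v m" using yh hn u by (intro eq_vecI) auto
    then show False using u by simp
  qed
  moreover have "\<forall>i<n. i \<notin> J \<longrightarrow> y $ i = 0" by (simp add: y_def)
  ultimately show ?thesis using yc by blast
qed

text \<open>
  A group inverse \<open>S\<close> of \<open>N = c - a\<close> splits the space into the kernel and the image of \<open>N\<close>, because
  \<open>v = (v - S N v) + N S v\<close>. Choose an invertible \<open>P\<close> with as few columns as possible that are not
  eigenvectors, and let \<open>J\<close> be the set of these columns. By the exchange lemma (Cramer's rule) every
  eigenvector has zero coordinates in \<open>J\<close>. If \<open>J\<close> were nonempty, some combination of the rows of
  \<open>P\<^sup>-\<^sup>1\<close> with index in \<open>J\<close> would be a left eigenvector \<open>z\<close> of \<open>c\<close>, for an eigenvalue \<open>a\<close>.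
  It kills the kernel of \<open>c - a\<close>, which consists of eigenvectors, and it kills the image of \<open>c - a\<close> as a left eigenvector. Hence \<open>z = 0\<close>, a contradiction.
\<close>

lemma diagonalizable_if_group_inverses:
  fixes c :: "'r::alg_closed_field mat"
  assumes c: "c \<in> carrier_mat n n"
    and inverses: "\<And>a. \<exists>S\<in>carrier_mat n n.
      char_matrix c a * S * char_matrix c a = char_matrix c a \<and>
      S * char_matrix c a = char_matrix c a * S"
  shows "diagonalizable c"
proof -
  \<comment> \<open>The zero vector is included; the columns of an invertible matrix are nonzero anyway.\<close>
  define eig where "eig w \<longleftrightarrow> (\<exists>a. c *\<^sub>v w = a \<cdot>\<^sub>v w)" for w
  define J where "J P = {j\<in>{..<n}. \<not> eig (col P j)}" for P
  have "\<exists>P. (P \<in> carrier_mat n n \<and> det P \<noteq> 0) \<and>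
      (\<forall>P'. P' \<in> carrier_mat n n \<and> det P' \<noteq> 0 \<longrightarrow> card (J P) \<le> card (J P'))"
    by (rule ex_has_least_nat[of _ "1\<^sub>m n"]) simp
  then obtain P where P: "P \<in> carrier_mat n n" and detP: "det P \<noteq> 0"
    and min: "\<And>P'. P' \<in> carrier_mat n n \<Longrightarrow> det P' \<noteq> 0 \<Longrightarrow> card (J P) \<le> card (J P')"
    by blast
  obtain Q where Q: "Q \<in> carrier_mat n n" and PQ: "P * Q = 1\<^sub>m n" and QP: "Q * P = 1\<^sub>m n"
    using det_non_zero_imp_unit[OF P detP, of "()"] unfolding Units_def ring_mat_simps by blast
  have coord: "(Q *\<^sub>v w) $ j = 0" if w: "w \<in> carrier_vec n" "eig w" and j: "j \<in> J P" for w j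
  proof (rule ccontr)
    assume nz: "(Q *\<^sub>v w) $ j \<noteq> 0"
    have jn: "j < n" using j by (simp add: J_def)
    have PQw: "P *\<^sub>v (Q *\<^sub>v w) = w"
      using w P Q PQ by (simp flip: assoc_mult_mat_vec)
    let ?P = "replace_col P w j"
    have P': "?P \<in> carrier_mat n n" using P by (simp add: replace_col_def)
    have "det ?P = (Q *\<^sub>v w) $ j * det P"
      using cramer_lemma_mat[OF P, of "Q *\<^sub>v w" j] PQw Q w jn by simp
    then have "card (J P) \<le> card (J ?P)" using min[OF P'] nz detP by simp
    moreover have "col ?P i = (if i = j then w else col P i)" if "i < n" for i
      using that P w by (intro eq_vecI) (auto simp: replace_col_def)
    then have "J ?P \<subseteq> J P - {j}" using w unfolding J_def by (auto split: if_splits)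
    then have "card (J ?P) \<le> card (J P - {j})" by (rule card_mono[rotated]) (simp add: J_def)
    moreover have "card (J P - {j}) < card (J P)"
      by (rule card_Diff1_less) (use j in \<open>auto simp: J_def\<close>)
    ultimately show False by simp
  qed
  have empty: "J P = {}"
  proof (rule ccontr)
    assume ne: "J P \<noteq> {}"
    define M where "M = Q * c * P"
    have M: "M \<in> carrier_mat n n" using Q c P by (simp add: M_def)
    have "M $$ (j,i) = 0" if j: "j \<in> J P" and i: "i < n" "i \<notin> J P" for j i
    proof -
      obtain a where a: "c *\<^sub>v col P i = a \<cdot>\<^sub>v col P i" using i by (auto simp: J_def eig_def)
      have Pi: "col P i \<in> carrier_vec n" using P i by (auto simp: col_dim)
      then have "col M i = Q *\<^sub>v (c *\<^sub>v col P i)"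
        using col_mult2[of "Q * c" n n P n i] assoc_mult_mat_vec[OF Q c] Q c P i by (simp add: M_def)
      also have "\<dots> = a \<cdot>\<^sub>v col (Q * P) i"
        using mult_mat_vec[OF Q Pi] col_mult2[OF Q P i(1)] by (simp add: a)
      also have "\<dots> = a \<cdot>\<^sub>v unit_vec n i" using i by (simp add: QP)
      finally have "col M i $ j = (a \<cdot>\<^sub>v unit_vec n i) $ j" by simp
      moreover have "j < n" "j \<noteq> i" using i j by (auto simp: J_def)
      ultimately show ?thesis using i M by simp
    qed
    then obtain y a where y: "y \<in> carrier_vec n" "y \<noteq> 0\<^sub>v n"
      and supp: "\<And>i. i < n \<Longrightarrow> i \<notin> J P \<Longrightarrow> y $ i = 0" and My: "transpose_mat M *\<^sub>v y = a \<cdot>\<^sub>v y"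
      using left_eigenvector_supported_on[OF M, of "J P"] ne by (auto simp: J_def)
    \<comment> \<open>The left eigenvector of \<open>c\<close> as a functional, with coordinates \<open>y\<close> in the rows of \<open>Q\<close>.\<close>
    define z where "z v = y \<bullet> (Q *\<^sub>v v)" for v
    have z_eig: "z w = 0" if "w \<in> carrier_vec n" "eig w" for w
    proof -
      have "y $ i * (Q *\<^sub>v w) $ i = 0" if "i < n" for i
        using coord[OF \<open>w \<in> carrier_vec n\<close> \<open>eig w\<close>] supp that by (cases "i \<in> J P") auto
      then show ?thesis
        unfolding z_def scalar_prod_def using Q by (intro sum.neutral) (auto simp del: index_mult_mat_vec)
    qed
    have z_c: "z (c *\<^sub>v v) = a * z v" if v: "v \<in> carrier_vec n" for v
    proof -
      have "Q * c = M * Q"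
        unfolding M_def using Q c P PQ by (simp add: assoc_mult_mat[of _ n n _ n _ n])
      then have "Q *\<^sub>v (c *\<^sub>v v) = M *\<^sub>v (Q *\<^sub>v v)"
        using Q c M v by (simp flip: assoc_mult_mat_vec)
      then have "z (c *\<^sub>v v) = (transpose_mat M *\<^sub>v y) \<bullet> (Q *\<^sub>v v)"
        unfolding z_def using transpose_vec_mult_scalar[of M n n "Q *\<^sub>v v" y] M Q v y by simp
      then show ?thesis unfolding My z_def using y Q v by simp
    qed
    have z_add: "z (v + w) = z v + z w" if "v \<in> carrier_vec n" "w \<in> carrier_vec n" for v w
      unfolding z_def using that Q y
      by (simp add: mult_add_distrib_mat_vec[of _ n n] scalar_prod_add_distrib[of _ n])
    have z_smult: "z (k \<cdot>\<^sub>v v) = k * z v" if "v \<in> carrier_vec n" for v k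
      unfolding z_def using that Q y by (simp add: mult_mat_vec[of _ n n])
    define N where "N = char_matrix c a"
    have N: "N \<in> carrier_mat n n" using c by (simp add: N_def char_matrix_def)
    have Nv: "N *\<^sub>v v = c *\<^sub>v v + (- a) \<cdot>\<^sub>v v" if "v \<in> carrier_vec n" for v
    proof -
      have "(- a \<cdot>\<^sub>m 1\<^sub>m n) *\<^sub>v v = - a \<cdot>\<^sub>v v"
        using that by (intro eq_vecI) auto
      then show ?thesis
        unfolding N_def char_matrix_def using that c by (simp add: add_mult_distrib_mat_vec[of _ n n])
    qed
    have z_N: "z (N *\<^sub>v v) = 0" if "v \<in> carrier_vec n" for v
      using that c by (simp add: Nv z_add z_c z_smult)
    obtain S where S: "S \<in> carrier_mat n n" and NSN: "N * S * N = N" and SN: "S * N = N * S"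
      using inverses[of a] N_def by auto
    have z0: "z v = 0" if v: "v \<in> carrier_vec n" for v
    proof -
      let ?w = "v - S *\<^sub>v (N *\<^sub>v v)"
      have w: "?w \<in> carrier_vec n" using v S N by simp
      have "N *\<^sub>v ?w = N *\<^sub>v v - (N * S * N) *\<^sub>v v"
        using v S N by (simp add: mult_minus_distrib_mat_vec[of _ n n] assoc_mult_mat_vec[of _ n n _ n] assoc_mult_mat[of _ n n _ n _ n])
      then have "N *\<^sub>v ?w = 0\<^sub>v n" using NSN N v by simp
      then have "c *\<^sub>v ?w = a \<cdot>\<^sub>v ?w"
        using eigenvector_char_matrix[OF c, of ?w a] w c
        unfolding N_def[symmetric] eigenvector_def by (cases "?w = 0\<^sub>v n") auto
      then have "z ?w = 0" using z_eig[OF w] by (auto simp: eig_def)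
      moreover have "S *\<^sub>v (N *\<^sub>v v) = N *\<^sub>v (S *\<^sub>v v)"
        using SN S N v by (simp flip: assoc_mult_mat_vec)
      then have "z (S *\<^sub>v (N *\<^sub>v v)) = 0" using z_N S v by simp
      moreover have "v = ?w + S *\<^sub>v (N *\<^sub>v v)" using v S N by auto
      ultimately show ?thesis using z_add[OF w, of "S *\<^sub>v (N *\<^sub>v v)"] S N v by simp
    qed
    have "y $ i = 0" if "i < n" for i
    proof -
      have "z (P *\<^sub>v unit_vec n i) = y \<bullet> unit_vec n i"
        unfolding z_def using P Q QP by (simp flip: assoc_mult_mat_vec)
      then show ?thesis using z0[of "P *\<^sub>v unit_vec n i"] P y that by simp
    qed
    then have "y = 0\<^sub>v n" using y by (intro eq_vecI) auto
    then show False using y by simp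
  qed
  then have "\<forall>j<n. \<exists>a. c *\<^sub>v col P j = a \<cdot>\<^sub>v col P j" by (auto simp: J_def eig_def)
  then obtain ev where ev: "\<And>j. j < n \<Longrightarrow> c *\<^sub>v col P j = ev j \<cdot>\<^sub>v col P j" by metis
  define d where "d = mat n n (\<lambda>(i,j). if i = j then ev j else 0)"
  have d: "d \<in> carrier_mat n n" by (simp add: d_def)
  have "c * P = P * d"
  proof (rule eq_matI)
    fix i j assume "i < dim_row (P * d)" "j < dim_col (P * d)"
    then have ij: "i < n" "j < n" using P d by auto
    have "(c * P) $$ (i,j) = (c *\<^sub>v col P j) $ i" using ij c P by simp
    also have "\<dots> = ev j * P $$ (i,j)" using ij P by (simp add: ev)
    also have "\<dots> = (\<Sum>k = 0..<n. if k = j then ev j * P $$ (i,j) else 0)" using ij by simp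
    also have "\<dots> = (\<Sum>k = 0..<n. P $$ (i,k) * (if k = j then ev j else 0))"
      by (rule sum.cong) auto
    also have "\<dots> = (P * d) $$ (i,j)" using ij P by (simp add: d_def scalar_prod_def)
    finally show "(c * P) $$ (i,j) = (P * d) $$ (i,j)" .
  qed (use c P d in auto)
  then have "c = P * d * Q"
    using assoc_mult_mat[OF c P Q] PQ c by simp
  then have "similar_mat_wit c d P Q"
    using c d P Q PQ QP by (auto simp: similar_mat_wit_def Let_def)
  moreover have "diagonal_mat d" by (auto simp: diagonal_mat_def d_def)
  ultimately show ?thesis unfolding diagonalizable_def similar_mat_def by blast
qed

section \<open>Separable centralizers\<close>

lemma centralizer_ring_simps [simp]:
  "carrier (centralizer_ring n c) = {a \<in> carrier_mat n n. a * c = c * a}"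
  "a \<otimes>\<^bsub>centralizer_ring n c\<^esub> b = a * b" "\<one>\<^bsub>centralizer_ring n c\<^esub> = 1\<^sub>m n"
  "a \<oplus>\<^bsub>centralizer_ring n c\<^esub> b = a + b" "\<zero>\<^bsub>centralizer_ring n c\<^esub> = 0\<^sub>m n n"
  by (simp_all add: centralizer_ring_def ring_mat_def)

lemma scalar_mat_mult:
  fixes a :: "'r::comm_ring_1 mat"
  assumes "a \<in> carrier_mat n n"
  shows "scalar_mat n r * a = r \<cdot>\<^sub>m a" "a * scalar_mat n r = r \<cdot>\<^sub>m a"
  using assms mult_smult_assoc_mat[of "1\<^sub>m n" n n a n r] mult_smult_distrib[of a n n "1\<^sub>m n" n r]
  by (simp_all add: scalar_mat_def)

lemma scalar_mat_carrier [simp]: "scalar_mat n r \<in> carrier_mat n n"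
  by (simp add: scalar_mat_def)

lemma centralizer_ring_extension:
  fixes c :: "'r::comm_ring_1 mat"
  assumes c: "c \<in> carrier_mat n n"
  shows "extension (centralizer_ring n c) (class_ring :: 'r ring) (scalar_mat n)"
proof -
  let ?S = "ring_mat TYPE('r) n ()"
  interpret S: ring ?S by (rule ring_mat)
  have "subring {a \<in> carrier_mat n n. a * c = c * a} ?S"
  proof (rule S.subringI)
    fix a assume a: "a \<in> {a \<in> carrier_mat n n. a * c = c * a}"
    have "\<ominus>\<^bsub>?S\<^esub> a = - a"
      by (rule S.minus_equality) (use a in \<open>auto simp: ring_mat_simps\<close>)
    then show "\<ominus>\<^bsub>?S\<^esub> a \<in> {a \<in> carrier_mat n n. a * c = c * a}"
      using a c by auto
    fix b assume b: "b \<in> {a \<in> carrier_mat n n. a * c = c * a}"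
    have "a * b * c = a * (c * b)" using a b c by (simp add: assoc_mult_mat[of a n n b n c n])
    also have "\<dots> = c * (a * b)"
      using a b c by (simp flip: assoc_mult_mat[of a n n c n b n] assoc_mult_mat[of c n n a n b n])
    finally show "a \<otimes>\<^bsub>?S\<^esub> b \<in> {a \<in> carrier_mat n n. a * c = c * a}"
      using a b by (auto simp: ring_mat_simps)
    show "a \<oplus>\<^bsub>?S\<^esub> b \<in> {a \<in> carrier_mat n n. a * c = c * a}"
      using a b c by (auto simp: ring_mat_simps add_mult_distrib_mat[of _ n n] mult_add_distrib_mat[of _ n n])
  qed (use c in \<open>auto simp: ring_mat_simps\<close>)
  then have ring: "ring (centralizer_ring n c)"
    unfolding centralizer_ring_def by (rule S.subring_is_ring)
  have "scalar_mat n \<in> Ring.ring_hom (class_ring :: 'r ring) (centralizer_ring n c)"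
    using c by (auto simp: Ring.ring_hom_def scalar_mat_mult) (auto simp: scalar_mat_def intro!: eq_matI)
  then show ?thesis
    using ring class_ring.ring_axioms by (simp add: extension_def extension_axioms_def)
qed

text \<open>
  Every matrix \<open>c - a\<close> is central in the centralizer \<open>A\<close> of \<open>c\<close>, and it has some inner inverse \<open>M\<close>, which
  commutes with the scalars. Averaging \<open>M\<close> over \<open>A\<close> gives an inner inverse that commutes with \<open>A\<close>, in
  particular with \<open>c - a\<close>, which itself belongs to \<open>A\<close>.
\<close>

lemma diagonalizable_if_centralizer_separable:
  fixes c :: "'r::alg_closed_field mat"
  assumes c: "c \<in> carrier_mat n n"
    and sep: "separable_extension (centralizer_ring n c) (class_ring :: 'r ring) (scalar_mat n)"
  shows "diagonalizable c"
proof (rule diagonalizable_if_group_inverses[OF c])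
  fix a
  let ?S = "ring_mat TYPE('r) n ()" and ?A = "centralizer_ring n c" and ?N = "char_matrix c a"
  interpret ext: extension ?A "class_ring :: 'r ring" "scalar_mat n"
    by (rule centralizer_ring_extension[OF c])
  have id: "id \<in> Ring.ring_hom ?A ?S" by (auto simp: Ring.ring_hom_def ring_mat_simps)
  have N: "?N \<in> carrier_mat n n" using c by simp
  have comm: "b * ?N = ?N * b" if "b \<in> carrier_mat n n" "b * c = c * b" for b
  proof -
    have "?N = c + scalar_mat n (- a)" using c by (simp add: char_matrix_def scalar_mat_def)
    then show ?thesis
      using that c by (simp add: mult_add_distrib_mat[of _ n n] add_mult_distrib_mat[of _ n n] scalar_mat_mult)
  qed
  then have N_CA: "?N \<in> commutant ?S (id ` carrier ?A)"
    using N by (auto simp: commutant_def ring_mat_simps)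
  obtain M where M: "M \<in> carrier_mat n n" "?N * M * ?N = ?N"
    using square_matrix_von_Neumann_regular[OF N] by blast
  have "M \<in> commutant ?S (id ` scalar_mat n ` carrier (class_ring :: 'r ring))"
    using M(1) by (auto simp: commutant_def ring_mat_simps scalar_mat_mult)
  from ext.commutant_regular_if_separable[OF sep ring_mat id N_CA this]
  obtain k where k: "k \<in> commutant ?S (id ` carrier ?A)" "?N * k * ?N = ?N"
    using M(2) by (auto simp: ring_mat_simps)
  have "?N \<in> id ` carrier ?A" using N comm[OF c refl] by simp
  then have "k * ?N = ?N * k" "k \<in> carrier_mat n n"
    using k(1) unfolding commutant_def by (auto simp: ring_mat_simps)
  then show "\<exists>k\<in>carrier_mat n n. ?N * k * ?N = ?N \<and> k * ?N = ?N * k" using k(2) by blast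
qed

section \<open>Centralizers of diagonalizable matrices\<close>

locale diagonalization =
  fixes n :: nat and c d P Q :: "'r::field mat"
  assumes c: "c \<in> carrier_mat n n" and d: "d \<in> carrier_mat n n"
    and P: "P \<in> carrier_mat n n" and Q: "Q \<in> carrier_mat n n"
    and PQ: "P * Q = 1\<^sub>m n" and QP: "Q * P = 1\<^sub>m n"
    and c_eq: "c = P * d * Q" and diag: "diagonal_mat d"
begin

abbreviation A :: "'r mat ring"
  where "A \<equiv> centralizer_ring n c"

abbreviation R :: "'r ring"
  where "R \<equiv> class_ring"

sublocale ext: extension A R "scalar_mat n"
  by (rule centralizer_ring_extension[OF c])

text \<open>
  The matrix of \<open>a\<close> with respect to the eigenbasis formed by the columns of \<open>P\<close>.
\<close>

definition coord :: "'r mat \<Rightarrow> 'r mat"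
  where "coord a = Q * a * P"

definition of_coord :: "'r mat \<Rightarrow> 'r mat"
  where "of_coord u = P * u * Q"

lemma coord_carrier [simp]: "a \<in> carrier_mat n n \<Longrightarrow> coord a \<in> carrier_mat n n"
  using P Q by (simp add: coord_def)

lemma coord_dim [simp]: "dim_row (coord a) = n" "dim_col (coord a) = n"
  using P Q by (simp_all add: coord_def)

lemma of_coord_carrier [simp]: "u \<in> carrier_mat n n \<Longrightarrow> of_coord u \<in> carrier_mat n n"
  using P Q by (simp add: of_coord_def)

lemma coord_of_coord: assumes "u \<in> carrier_mat n n" shows "coord (of_coord u) = u"
proof -
  have "coord (of_coord u) = (Q * P) * u * (Q * P)"
    unfolding coord_def of_coord_def using assms P Q by (simp add: assoc_mult_mat[of _ n n _ n _ n])
  then show ?thesis using assms QP by simp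
qed

lemma of_coord_coord: assumes "a \<in> carrier_mat n n" shows "of_coord (coord a) = a"
proof -
  have "of_coord (coord a) = (P * Q) * a * (P * Q)"
    unfolding coord_def of_coord_def using assms P Q by (simp add: assoc_mult_mat[of _ n n _ n _ n])
  then show ?thesis using assms PQ by simp
qed

lemma coord_mult:
  assumes "a \<in> carrier_mat n n" "b \<in> carrier_mat n n" shows "coord (a * b) = coord a * coord b"
proof -
  have "coord a * coord b = Q * a * (P * Q) * b * P"
    unfolding coord_def using assms P Q by (simp add: assoc_mult_mat[of _ n n _ n _ n])
  then show ?thesis
    unfolding coord_def PQ using assms P Q by (simp add: assoc_mult_mat[of _ n n _ n _ n])
qed

lemma coord_add:
  assumes "a \<in> carrier_mat n n" "b \<in> carrier_mat n n" shows "coord (a + b) = coord a + coord b"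
  unfolding coord_def using assms P Q
  by (simp add: mult_add_distrib_mat[of _ n n] add_mult_distrib_mat[of _ n n])

lemma coord_one: "coord (1\<^sub>m n) = 1\<^sub>m n"
  unfolding coord_def using P Q QP by simp

lemma coord_smult:
  assumes "a \<in> carrier_mat n n" shows "coord (r \<cdot>\<^sub>m a) = r \<cdot>\<^sub>m coord a"
  unfolding coord_def using assms P Q mult_smult_distrib[of Q n n a n r] mult_smult_assoc_mat[of "Q * a" n n P n r]
  by simp

lemma coord_c: "coord c = d"
  using coord_of_coord[OF d] by (simp add: of_coord_def c_eq)

lemma eq_if_coord_eq:
  assumes "a \<in> carrier_mat n n" "b \<in> carrier_mat n n"
    and "\<And>k l. k < n \<Longrightarrow> l < n \<Longrightarrow> coord a $$ (k,l) = coord b $$ (k,l)"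
  shows "a = b"
proof -
  have "coord a = coord b"
    by (rule eq_matI) (simp_all add: assms(3))
  then show ?thesis using of_coord_coord assms(1,2) by metis
qed

abbreviation ev :: "nat \<Rightarrow> 'r"
  where "ev i \<equiv> d $$ (i,i)"

text \<open>
  In the eigenbasis the centralizer consists of the block diagonal matrices, one block for each
  eigenvalue: commuting with \<open>d\<close> means that \<open>x\<^sub>k\<^sub>l ev l = ev k x\<^sub>k\<^sub>l\<close> for the coordinates \<open>x\<^sub>k\<^sub>l\<close>.
\<close>

lemma mem_centralizer_iff:
  assumes a: "a \<in> carrier_mat n n"
  shows "a * c = c * a \<longleftrightarrow> (\<forall>k<n. \<forall>l<n. ev k \<noteq> ev l \<longrightarrow> coord a $$ (k,l) = 0)"
proof -
  have left: "(coord a * d) $$ (k,l) = coord a $$ (k,l) * ev l" if "k < n" "l < n" for k l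
  proof -
    have "(coord a * d) $$ (k,l) = (\<Sum>i = 0..<n. coord a $$ (k,i) * d $$ (i,l))"
      using that d by (simp add: scalar_prod_def)
    also have "\<dots> = (\<Sum>i = 0..<n. if i = l then coord a $$ (k,l) * ev l else 0)"
      by (rule sum.cong) (use that d diag in \<open>auto simp: diagonal_mat_def\<close>)
    finally show ?thesis using that by simp
  qed
  have right: "(d * coord a) $$ (k,l) = ev k * coord a $$ (k,l)" if "k < n" "l < n" for k l
  proof -
    have "(d * coord a) $$ (k,l) = (\<Sum>i = 0..<n. d $$ (k,i) * coord a $$ (i,l))"
      using that d by (simp add: scalar_prod_def)
    also have "\<dots> = (\<Sum>i = 0..<n. if i = k then ev k * coord a $$ (k,l) else 0)"
      by (rule sum.cong) (use that d diag in \<open>auto simp: diagonal_mat_def\<close>)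
    finally show ?thesis using that by simp
  qed
  have "a * c = c * a \<longleftrightarrow> coord (a * c) = coord (c * a)"
  proof
    assume "coord (a * c) = coord (c * a)"
    then have "of_coord (coord (a * c)) = of_coord (coord (c * a))" by (rule arg_cong)
    then show "a * c = c * a" using of_coord_coord[of "a * c"] of_coord_coord[of "c * a"] a c by simp
  qed simp
  also have "\<dots> \<longleftrightarrow> coord a * d = d * coord a" using a c by (simp add: coord_mult coord_c)
  also have "\<dots> \<longleftrightarrow> (\<forall>k<n. \<forall>l<n. (coord a * d) $$ (k,l) = (d * coord a) $$ (k,l))"
    using d by (auto intro!: eq_matI simp del: index_mult_mat(1))
  also have "\<dots> \<longleftrightarrow> (\<forall>k<n. \<forall>l<n. coord a $$ (k,l) * ev l = ev k * coord a $$ (k,l))"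
    using left right by simp
  also have "\<dots> \<longleftrightarrow> (\<forall>k<n. \<forall>l<n. ev k \<noteq> ev l \<longrightarrow> coord a $$ (k,l) = 0)"
  proof -
    have "z * ev l = ev k * z \<longleftrightarrow> (ev k \<noteq> ev l \<longrightarrow> z = 0)" for z k l by (auto simp: mult.commute)
    then show ?thesis by simp
  qed
  finally show ?thesis .
qed

text \<open>
  The matrix unit at \<open>(i,j)\<close> in the eigenbasis; it is zero if an index is out of range.
\<close>

definition U :: "nat \<Rightarrow> nat \<Rightarrow> 'r mat"
  where "U i j = of_coord (mat n n (\<lambda>(k,l). if k = i \<and> l = j then 1 else 0))"

lemma U_carrier [simp]: "U i j \<in> carrier_mat n n"
  by (simp add: U_def)

lemma coord_U:
  assumes "k < n" "l < n" shows "coord (U i j) $$ (k,l) = (if k = i \<and> l = j then 1 else 0)"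
  using assms by (simp add: U_def coord_of_coord)

lemma U_in_A: "ev i = ev j \<Longrightarrow> U i j \<in> carrier A"
  using mem_centralizer_iff[OF U_carrier[of i j]] by (auto simp: coord_U)

lemma coord_U_mult:
  assumes x: "x \<in> carrier_mat n n" and "j < n" "k < n" "l < n"
  shows "coord (U i j * x) $$ (k,l) = (if k = i then coord x $$ (j,l) else 0)"
proof -
  have "coord (U i j * x) $$ (k,l) = (\<Sum>m = 0..<n. coord (U i j) $$ (k,m) * coord x $$ (m,l))"
    using assms by (simp add: coord_mult scalar_prod_def)
  also have "\<dots> = (\<Sum>m = 0..<n. if m = j then (if k = i then coord x $$ (j,l) else 0) else 0)"
    by (rule sum.cong) (use assms in \<open>auto simp: coord_U\<close>)
  finally show ?thesis using assms by simp
qed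

lemma coord_mult_U:
  assumes x: "x \<in> carrier_mat n n" and "i < n" "k < n" "l < n"
  shows "coord (x * U i j) $$ (k,l) = (if l = j then coord x $$ (k,i) else 0)"
proof -
  have "coord (x * U i j) $$ (k,l) = (\<Sum>m = 0..<n. coord x $$ (k,m) * coord (U i j) $$ (m,l))"
    using assms by (simp add: coord_mult scalar_prod_def)
  also have "\<dots> = (\<Sum>m = 0..<n. if m = i then (if l = j then coord x $$ (k,i) else 0) else 0)"
    by (rule sum.cong) (use assms in \<open>auto simp: coord_U\<close>)
  finally show ?thesis using assms by simp
qed

lemma coord_U_scalar:
  assumes "k < n" "l < n"
  shows "coord (U i j * scalar_mat n r) $$ (k,l) = (if k = i \<and> l = j then r else 0)"
    and "coord (scalar_mat n r * U i j) $$ (k,l) = (if k = i \<and> l = j then r else 0)"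
  using assms
  by (simp_all add: scalar_mat_mult coord_smult coord_U)

lemma coord_finsum:
  assumes "finite I" and f: "\<And>i. i \<in> I \<Longrightarrow> f i \<in> carrier A" and kl: "k < n" "l < n"
  shows "coord (\<Oplus>\<^bsub>A\<^esub>i\<in>I. f i) $$ (k,l) = (\<Sum>i\<in>I. coord (f i) $$ (k,l))"
  using assms(1) f
proof induction
  case empty
  then show ?case using kl P Q by (simp add: coord_def)
next
  case (insert i I)
  have fi: "f i \<in> carrier A" and fI: "f \<in> I \<rightarrow> carrier A" using insert.prems by blast+
  have sumI: "(\<Oplus>\<^bsub>A\<^esub>i\<in>I. f i) \<in> carrier A" by (rule ext.A.finsum_closed[OF fI])
  have "(\<Oplus>\<^bsub>A\<^esub>i\<in>insert i I. f i) = f i + (\<Oplus>\<^bsub>A\<^esub>i\<in>I. f i)"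
    using ext.A.finsum_insert[OF insert.hyps fI fi] by simp
  moreover have "coord (f i + (\<Oplus>\<^bsub>A\<^esub>i\<in>I. f i)) = coord (f i) + coord (\<Oplus>\<^bsub>A\<^esub>i\<in>I. f i)"
    by (rule coord_add) (use fi sumI in auto)
  moreover have "coord (\<Oplus>\<^bsub>A\<^esub>i\<in>I. f i) \<in> carrier_mat n n" using sumI by simp
  ultimately show ?case using insert kl by simp
qed

lemma finsum_eqI:
  assumes "finite I" and f: "\<And>i. i \<in> I \<Longrightarrow> f i \<in> carrier A" and x: "x \<in> carrier A"
    and eq: "\<And>k l. k < n \<Longrightarrow> l < n \<Longrightarrow> (\<Sum>i\<in>I. coord (f i) $$ (k,l)) = coord x $$ (k,l)"
  shows "(\<Oplus>\<^bsub>A\<^esub>i\<in>I. f i) = x"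
proof (rule eq_if_coord_eq)
  have "f \<in> I \<rightarrow> carrier A" using f by blast
  then show "(\<Oplus>\<^bsub>A\<^esub>i\<in>I. f i) \<in> carrier_mat n n" using ext.A.finsum_closed[of f I] by simp
  show "x \<in> carrier_mat n n" using x by simp
  show "coord (\<Oplus>\<^bsub>A\<^esub>i\<in>I. f i) $$ (k,l) = coord x $$ (k,l)" if "k < n" "l < n" for k l
    using coord_finsum[OF assms(1) f that] eq[OF that] by (rule trans)
qed

text \<open>
  The trace, computed in the eigenbasis.
\<close>

definition tr :: "'r mat \<Rightarrow> 'r"
  where "tr a = (\<Sum>i<n. coord a $$ (i,i))"

lemma tr_U:
  assumes "x \<in> carrier_mat n n" "i < n" "j < n"
  shows "tr (U j i * x) = coord x $$ (i,j)" and "tr (x * U i j) = coord x $$ (j,i)"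
proof -
  have "tr (U j i * x) = (\<Sum>k<n. if k = j then coord x $$ (i,j) else 0)"
    unfolding tr_def by (rule sum.cong) (use assms in \<open>auto simp: coord_U_mult\<close>)
  then show "tr (U j i * x) = coord x $$ (i,j)" using assms by simp
  have "tr (x * U i j) = (\<Sum>k<n. if k = j then coord x $$ (j,i) else 0)"
    unfolding tr_def by (rule sum.cong) (use assms in \<open>auto simp: coord_mult_U\<close>)
  then show "tr (x * U i j) = coord x $$ (j,i)" using assms by simp
qed

lemma tr_bimod_hom: "tr \<in> bimod_hom R R (ring_bimod A (scalar_mat n) (scalar_mat n)) (ring_bimod R id id)"
proof -
  have add: "tr (a + b) = tr a + tr b" if "a \<in> carrier_mat n n" "b \<in> carrier_mat n n" for a b
    unfolding tr_def using that
    by (simp add: coord_add sum.distrib)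
  have smult: "tr (r \<cdot>\<^sub>m a) = r * tr a" if "a \<in> carrier_mat n n" for a r
    unfolding tr_def using that by (simp add: coord_smult sum_distrib_left)
  show ?thesis
    by (auto simp: bimod_hom_def rmod_hom_def hom_def add smult scalar_mat_mult mult.commute)
qed

definition block :: "(nat \<times> nat) set"
  where "block = {(i,j). i < n \<and> j < n \<and> ev i = ev j}"

lemma finite_block: "finite block"
  by (rule finite_subset[of _ "{..<n} \<times> {..<n}"]) (auto simp: block_def)

lemma coord_eq_0: "\<lbrakk>x \<in> carrier A; k < n; l < n; (k,l) \<notin> block\<rbrakk> \<Longrightarrow> coord x $$ (k,l) = 0"
  using mem_centralizer_iff[of x] by (auto simp: block_def)

text \<open>
  The trace form of a product of full matrix algebras: \<open>U j i\<close> is dual to \<open>U i j\<close>.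
\<close>

lemma frobenius: "frobenius_extension A R (scalar_mat n)"
proof (rule ext.frobenius_extensionI[OF finite_block, where u = "\<lambda>p. U (fst p) (snd p)" and v = "\<lambda>p. U (snd p) (fst p)" and \<tau> = tr])
  show U: "U (fst p) (snd p) \<in> carrier A" "U (snd p) (fst p) \<in> carrier A" if "p \<in> block" for p
    using that by (auto simp: block_def intro!: U_in_A simp del: centralizer_ring_simps)
  show "tr \<in> bimod_hom R R (ring_bimod A (scalar_mat n) (scalar_mat n)) (ring_bimod R id id)"
    by (rule tr_bimod_hom)
  fix x assume x: "x \<in> carrier A"
  then have xc: "x \<in> carrier_mat n n" by simp
  have scalar: "scalar_mat n r \<in> carrier A" for r by (rule ext.\<phi>_closed) simp
  show "(\<Oplus>\<^bsub>A\<^esub>p\<in>block. U (fst p) (snd p) \<otimes>\<^bsub>A\<^esub> scalar_mat n (tr (U (snd p) (fst p) \<otimes>\<^bsub>A\<^esub> x))) = x"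
  proof (rule finsum_eqI[OF finite_block _ x])
    fix k l assume kl: "k < n" "l < n"
    have "(\<Sum>p\<in>block. coord (U (fst p) (snd p) \<otimes>\<^bsub>A\<^esub> scalar_mat n (tr (U (snd p) (fst p) \<otimes>\<^bsub>A\<^esub> x))) $$ (k,l))
        = (\<Sum>p\<in>block. if p = (k,l) then coord x $$ (k,l) else 0)"
      by (rule sum.cong) (use kl xc in \<open>auto simp: block_def coord_U_scalar tr_U split: if_splits\<close>)
    then show "(\<Sum>p\<in>block. coord (U (fst p) (snd p) \<otimes>\<^bsub>A\<^esub> scalar_mat n (tr (U (snd p) (fst p) \<otimes>\<^bsub>A\<^esub> x))) $$ (k,l))
        = coord x $$ (k,l)"
      using finite_block coord_eq_0[OF x kl] by simp
  qed (use U scalar x in \<open>auto simp del: centralizer_ring_simps\<close>)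
  show "(\<Oplus>\<^bsub>A\<^esub>p\<in>block. scalar_mat n (tr (x \<otimes>\<^bsub>A\<^esub> U (fst p) (snd p))) \<otimes>\<^bsub>A\<^esub> U (snd p) (fst p)) = x"
  proof (rule finsum_eqI[OF finite_block _ x])
    fix k l assume kl: "k < n" "l < n"
    have "(\<Sum>p\<in>block. coord (scalar_mat n (tr (x \<otimes>\<^bsub>A\<^esub> U (fst p) (snd p))) \<otimes>\<^bsub>A\<^esub> U (snd p) (fst p)) $$ (k,l))
        = (\<Sum>p\<in>block. if p = (l,k) then coord x $$ (k,l) else 0)"
      by (rule sum.cong) (use kl xc in \<open>auto simp: block_def coord_U_scalar tr_U split: if_splits\<close>)
    moreover have "(l,k) \<in> block \<longleftrightarrow> (k,l) \<in> block" by (auto simp: block_def)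
    ultimately show "(\<Sum>p\<in>block. coord (scalar_mat n (tr (x \<otimes>\<^bsub>A\<^esub> U (fst p) (snd p))) \<otimes>\<^bsub>A\<^esub> U (snd p) (fst p)) $$ (k,l))
        = coord x $$ (k,l)"
      using finite_block coord_eq_0[OF x kl] by simp
  qed (use U scalar x in \<open>auto simp del: centralizer_ring_simps\<close>)
qed

text \<open>
  An arbitrary but fixed index in the block of \<open>j\<close>. A separability element of a full matrix algebra is
  \<open>\<Sum>\<^sub>j U j r \<otimes> U r j\<close> for one fixed \<open>r\<close>, and \<open>rep\<close> makes such a choice in each block. No division by the size of
  a block occurs, so this works in every characteristic.
\<close>

definition rep :: "nat \<Rightarrow> nat"
  where "rep j = (LEAST i. ev i = ev j)"

lemma ev_rep: "ev (rep j) = ev j"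
  unfolding rep_def by (rule LeastI[of _ j]) simp

lemma rep_less: "j < n \<Longrightarrow> rep j < n"
  unfolding rep_def by (rule le_less_trans[OF Least_le]) simp_all

lemma rep_cong: "ev j = ev l \<Longrightarrow> rep j = rep l"
  by (simp add: rep_def)

text \<open>
  Both \<open>t U\<^sub>l\<^sub>r\<close> and \<open>U\<^sub>r\<^sub>j t\<close> are governed by the coordinate matrix of \<open>t\<close>. An entry at \<open>(j,l)\<close> vanishes unless \<open>j\<close> and \<open>l\<close>
  lie in the same block, and then they have the same representative \<open>r\<close>.
\<close>

lemma separable: "separable_extension A R (scalar_mat n)"
proof (rule ext.separable_extensionI[of "{..<n}" "\<lambda>j. U j (rep j)" "\<lambda>j. U (rep j) j"])
  show U: "U j (rep j) \<in> carrier A" "U (rep j) j \<in> carrier A" for j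
    by (rule U_in_A, simp add: ev_rep)+
  have scalar: "scalar_mat n r \<in> carrier A" for r by (rule ext.\<phi>_closed) simp
  show "(\<Oplus>\<^bsub>A\<^esub>j\<in>{..<n}. U j (rep j) \<otimes>\<^bsub>A\<^esub> U (rep j) j) = \<one>\<^bsub>A\<^esub>"
  proof (rule finsum_eqI)
    fix k l assume kl: "k < n" "l < n"
    have "(\<Sum>j<n. coord (U j (rep j) \<otimes>\<^bsub>A\<^esub> U (rep j) j) $$ (k,l)) = (\<Sum>j<n. if j = k then (if k = l then 1 else 0) else 0)"
      by (rule sum.cong) (use kl rep_less in \<open>auto simp: coord_U_mult coord_U\<close>)
    then show "(\<Sum>j<n. coord (U j (rep j) \<otimes>\<^bsub>A\<^esub> U (rep j) j) $$ (k,l)) = coord \<one>\<^bsub>A\<^esub> $$ (k,l)"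
      using kl by (simp add: coord_one)
  qed (use U in \<open>auto simp del: centralizer_ring_simps\<close>)
  fix t assume t: "t \<in> carrier A"
  then have tc: "t \<in> carrier_mat n n" by simp
  have "t \<otimes>\<^bsub>A\<^esub> U l (rep l) = (\<Oplus>\<^bsub>A\<^esub>j\<in>{..<n}. U j (rep j) \<otimes>\<^bsub>A\<^esub> scalar_mat n (coord t $$ (j,l)))" if l: "l < n" for l
  proof (rule finsum_eqI[symmetric])
    fix k m assume km: "k < n" "m < n"
    have "rep k = rep l \<or> coord t $$ (k,l) = 0"
      using coord_eq_0[OF t km(1) l] rep_cong[of k l] by (cases "ev k = ev l") (simp_all add: block_def)
    moreover have "(\<Sum>j<n. coord (U j (rep j) \<otimes>\<^bsub>A\<^esub> scalar_mat n (coord t $$ (j,l))) $$ (k,m))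
        = (\<Sum>j<n. if j = k then (if m = rep k then coord t $$ (k,l) else 0) else 0)"
      by (rule sum.cong) (use km in \<open>auto simp: coord_U_scalar\<close>)
    ultimately show "(\<Sum>j<n. coord (U j (rep j) \<otimes>\<^bsub>A\<^esub> scalar_mat n (coord t $$ (j,l))) $$ (k,m)) = coord (t \<otimes>\<^bsub>A\<^esub> U l (rep l)) $$ (k,m)"
      using km l tc by (auto simp: coord_mult_U)
  qed (use U scalar t in \<open>auto simp del: centralizer_ring_simps\<close>)
  moreover have "U (rep j) j \<otimes>\<^bsub>A\<^esub> t = (\<Oplus>\<^bsub>A\<^esub>l\<in>{..<n}. scalar_mat n (coord t $$ (j,l)) \<otimes>\<^bsub>A\<^esub> U (rep l) l)" if j: "j < n" for j
  proof (rule finsum_eqI[symmetric])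
    fix k m assume km: "k < n" "m < n"
    have "rep j = rep m \<or> coord t $$ (j,m) = 0"
      using coord_eq_0[OF t j km(2)] rep_cong[of j m] by (cases "ev j = ev m") (simp_all add: block_def)
    moreover have "(\<Sum>l<n. coord (scalar_mat n (coord t $$ (j,l)) \<otimes>\<^bsub>A\<^esub> U (rep l) l) $$ (k,m))
        = (\<Sum>l<n. if l = m then (if k = rep m then coord t $$ (j,m) else 0) else 0)"
      by (rule sum.cong) (use km in \<open>auto simp: coord_U_scalar\<close>)
    ultimately show "(\<Sum>l<n. coord (scalar_mat n (coord t $$ (j,l)) \<otimes>\<^bsub>A\<^esub> U (rep l) l) $$ (k,m)) = coord (U (rep j) j \<otimes>\<^bsub>A\<^esub> t) $$ (k,m)"
      using km j tc by (auto simp: coord_U_mult)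
  qed (use U scalar t in \<open>auto simp del: centralizer_ring_simps\<close>)
  ultimately show "\<exists>\<alpha>. (\<forall>j\<in>{..<n}. \<forall>l\<in>{..<n}. \<alpha> j l \<in> carrier R) \<and>
      (\<forall>l\<in>{..<n}. t \<otimes>\<^bsub>A\<^esub> U l (rep l) = (\<Oplus>\<^bsub>A\<^esub>j\<in>{..<n}. U j (rep j) \<otimes>\<^bsub>A\<^esub> scalar_mat n (\<alpha> j l))) \<and>
      (\<forall>j\<in>{..<n}. U (rep j) j \<otimes>\<^bsub>A\<^esub> t = (\<Oplus>\<^bsub>A\<^esub>l\<in>{..<n}. scalar_mat n (\<alpha> j l) \<otimes>\<^bsub>A\<^esub> U (rep l) l))"
    by (intro exI[of _ "\<lambda>j l. coord t $$ (j,l)"]) auto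
qed simp

end

theorem corollary1p3:
  fixes n :: nat and c :: "'r::alg_closed_field mat"
  assumes "c \<in> carrier_mat n n"
  shows "diagonalizable c \<longleftrightarrow>
    separable_frobenius_algebra (class_ring :: 'r ring) (centralizer_ring n c) (scalar_mat n)"
proof
  assume "diagonalizable c"
  then obtain d P Q where diag: "diagonal_mat d" and sim: "similar_mat_wit c d P Q"
    by (auto simp: diagonalizable_def similar_mat_def)
  interpret diagonalization n c d P Q
    by unfold_locales (use similar_mat_witD2[OF assms sim] assms diag in auto)
  have "field (class_ring :: 'r ring)" by (rule class_field)
  moreover have "scalar_mat n r * x = x * scalar_mat n r" if "x \<in> carrier_mat n n" for r and x :: "'r mat"
    using that by (simp add: scalar_mat_mult)
  ultimately show "separable_frobenius_algebra (class_ring :: 'r ring) (centralizer_ring n c) (scalar_mat n)"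
    using frobenius separable
    by (simp add: separable_frobenius_algebra_def separable_frobenius_extension_def)
next
  assume "separable_frobenius_algebra (class_ring :: 'r ring) (centralizer_ring n c) (scalar_mat n)"
  then show "diagonalizable c"
    using diagonalizable_if_centralizer_separable[OF assms]
    by (simp add: separable_frobenius_algebra_def separable_frobenius_extension_def)
qed

end
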